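(* For every integer $n\ge 0$, $$s(9n) - 3 s(n) = 2\,(1,1,3,0,0,1)(n) - 4\,(4,3,4,0,4,0)(n).$$
   Context: For integers $a,b,c,d,e,f$, $(a,b,c,d,e,f)(n)$ denotes the number of representations of $n$ by the ternary quadratic form $ax^2+by^2+cz^2+dyz+ezx+fxy$, i.e. the number of triples $(x,y,z)\in\mathbb{Z}^3$ with $ax^2+by^2+cz^2+dyz+ezx+fxy=n$. In particular $(1,1,3,0,0,1)(n)$ counts $(x,y,z)\in\mathbb{Z}^3$ with $x^2+y^2+3z^2+xy=n$, and $(4,3,4,0,4,0)(n)$ counts those with $4x^2+3y^2+4z^2+4zx=n$. $s(n)$ denotes the number of triples $(x,y,z)\in\mathbb{Z}^3$ with $x^2+y^2+z^2=n$. *)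

theory Defs
  imports Main
begin

(* The coefficient order is that of the tuple notation: x^2, y^2, z^2, yz, zx, xy.
   For an indefinite or degenerate form the solution set can be infinite, and then card
   returns 0; for a positive definite form it is finite and this is the true count. *)
definition ternary_reps :: "int \<Rightarrow> int \<Rightarrow> int \<Rightarrow> int \<Rightarrow> int \<Rightarrow> int \<Rightarrow> int \<Rightarrow> nat" where
  "ternary_reps a b c d e f n =
     card {(x :: int, y :: int, z :: int).
       a * x^2 + b * y^2 + c * z^2 + d * y * z + e * z * x + f * x * y = n}"

definition three_squares_reps :: "int \<Rightarrow> nat" where
  "three_squares_reps n = card {(x :: int, y :: int, z :: int). x^2 + y^2 + z^2 = n}"

end

theory Submission
  imports Defs "HOL-Complex_Analysis.Cauchy_Integral_Formula"
begin

text \<open>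
  Let \<open>s(n)\<close> be the number of representations of \<open>n\<close> as a sum of three squares and \<open>M(n)\<close> the number of
  those with \<open>u + v + w\<close> divisible by 3. The reflection in the direction \<open>(1, 1, 1)\<close>, scaled by 3,
  together with sign changes gives \<open>s(9 n) = 5 s(n) - 4 M(n)\<close>, so that \<open>s(n) - 2 M(n)\<close> has to be compared
  with the two ternary forms. In terms of \<open>\<theta>(q) = \<Sum> q^(n^2)\<close> and \<open>a(q) = \<Sum> q^(x^2 + x y + y^2)\<close> this is
  the identity \<open>\<theta>(q)^3 = \<theta>(q^3) (2 a(q^2) + a(q) - 2 a(q^4))\<close>.

  All the binary theta series involved are, by elementary reindexing, algebraic in the values of \<open>\<theta>\<close> at
  \<open>q\<close>, \<open>-q\<close>, \<open>q^3\<close>, \<open>-q^3\<close>, and these values satisfy the cubic modular equation. The one relation that is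
  not of this kind comes from splitting \<open>\<theta>(\<plusminus>q) \<theta>(\<plusminus>q)^2\<close> according to \<open>u + v + w\<close> modulo 3: this
  expresses four products through four unknown series, which can be eliminated. For small positive \<open>q\<close>
  all quantities are positive, which selects the right roots in the resulting algebraic system.
\<close>

section \<open>Summability\<close>

lemma has_sum_times_real:
  fixes f :: "'a \<Rightarrow> real" and g :: "'b \<Rightarrow> real"
  assumes "f summable_on A" "g summable_on B"
  shows "((\<lambda>(x, y). f x * g y) has_sum infsum f A * infsum g B) (A \<times> B)"
proof -
  have "(\<lambda>y. norm (g y)) summable_on B" "(\<lambda>x. norm (f x)) summable_on A"
    using assms summable_on_iff_abs_summable_on_real by blast+
  then have "(\<lambda>p. norm (case p of (x, y) \<Rightarrow> f x * g y)) summable_on A \<times> B"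
    by (subst Infinite_Sum.abs_summable_on_Sigma_iff)
       (auto simp: abs_mult infsum_cmult_right' summable_on_cmult_right summable_on_cmult_left abs_mult infsum_nonneg)
  then have "(\<lambda>(x, y). f x * g y) summable_on A \<times> B"
    by (rule abs_summable_summable)
  then show ?thesis
    by (rule has_sum_SigmaI[rotated 2, where g = "\<lambda>x. f x * infsum g B"])
       (auto intro!: has_sum_cmult_right has_sum_cmult_left assms has_sum_infsum)
qed

text \<open>Majorant for every theta series below. Its explicit value also gives the upper bound for
  \<open>theta 1 q\<close> when 3 q < 1.\<close>

lemma has_sum_power_int_abs:
  fixes q :: real
  assumes "0 < q" "q < 1"
  shows "((\<lambda>n::int. q powi \<bar>n\<bar>) has_sum (1 + 2 * (q / (1 - q)))) UNIV"
proof -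
  have geo: "((\<lambda>n. q ^ n) has_sum (q / (1 - q))) {1..}"
    using has_sum_geometric_from_1[of q] assms by simp
  have pos: "((\<lambda>n::int. q powi \<bar>n\<bar>) has_sum (q / (1 - q))) {1..}"
    by (subst has_sum_reindex_bij_witness[of _ int nat "{1..}" "\<lambda>n. q ^ n" _ _ "q / (1 - q)"])
       (use geo in \<open>auto simp: power_int_def\<close>)
  have neg: "((\<lambda>n::int. q powi \<bar>n\<bar>) has_sum (q / (1 - q))) {..-1}"
    by (subst has_sum_reindex_bij_witness[of _ uminus uminus "{1..}" "\<lambda>n. q powi \<bar>n\<bar>" _ _ "q / (1 - q)"])
       (use pos in auto)
  have "((\<lambda>n::int. q powi \<bar>n\<bar>) has_sum (q / (1 - q) + q / (1 - q))) ({1..} \<union> {..-1})"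
    by (rule has_sum_Un_disjoint[OF pos neg]) auto
  then have "((\<lambda>n::int. q powi \<bar>n\<bar>) has_sum (q powi \<bar>0\<bar> + (q / (1 - q) + q / (1 - q)))) (insert 0 ({1..} \<union> {..-1}))"
    by (intro has_sum_insert) auto
  moreover have "insert 0 ({1..} \<union> {..-1}) = (UNIV :: int set)" by auto
  ultimately show ?thesis by simp
qed

text \<open>The constant \<open>c\<close> absorbs lower-order terms of the exponent at the cost of a
  factor \<open>q powi (- c)\<close>; \<open>e\<close> carries the signs of twisted series.\<close>

lemma summable_on_dominated:
  fixes q :: real and k l :: "'a \<Rightarrow> int"
  assumes "0 < q" "q < 1" "(\<lambda>x. q powi l x) summable_on UNIV"
    and "\<And>x. l x \<le> k x + c" "\<And>x. \<bar>e x\<bar> \<le> 1"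
  shows "(\<lambda>x. e x * q powi k x) summable_on A"
proof -
  have "(\<lambda>x. q powi (- c) * q powi l x) summable_on A"
    by (rule summable_on_cmult_right[OF summable_on_subset_banach[OF assms(3)]]) simp
  then have "(\<lambda>x. norm (e x * q powi k x)) summable_on A"
  proof (rule Infinite_Sum.abs_summable_on_comparison_test')
    fix x
    have "\<bar>e x\<bar> * q powi k x \<le> 1 * q powi (l x - c)"
      using assms(1,2,5) assms(4)[of x] by (intro mult_mono power_int_decreasing) auto
    then show "norm (e x * q powi k x) \<le> q powi (- c) * q powi l x"
      using assms(1) by (simp add: abs_mult flip: power_int_add)
  qed
  then show ?thesis by (rule abs_summable_summable)
qed

lemma summable_on_theta1:
  fixes q :: real and k :: "int \<Rightarrow> int"
  assumes "0 < q" "q < 1" "\<And>x. \<bar>x\<bar> \<le> k x + c" "\<And>x. \<bar>e x\<bar> \<le> 1"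
  shows "(\<lambda>x. e x * q powi k x) summable_on A"
  using summable_on_dominated[OF assms(1,2) _ assms(3,4)]
    has_sum_imp_summable[OF has_sum_power_int_abs[OF assms(1,2)]] .

lemma summable_on_theta2:
  fixes q :: real and k :: "int \<times> int \<Rightarrow> int"
  assumes "0 < q" "q < 1" "\<And>x y. \<bar>x\<bar> + \<bar>y\<bar> \<le> k (x, y) + c" "\<And>x. \<bar>e x\<bar> \<le> 1"
  shows "(\<lambda>x. e x * q powi k x) summable_on A"
proof -
  have "(\<lambda>(x :: int, y :: int). q powi \<bar>x\<bar> * q powi \<bar>y\<bar>) summable_on UNIV \<times> UNIV"
    using has_sum_imp_summable[OF has_sum_times_real]
      has_sum_imp_summable[OF has_sum_power_int_abs[OF assms(1,2)]] by blast
  also have "(\<lambda>(x :: int, y :: int). q powi \<bar>x\<bar> * q powi \<bar>y\<bar>) = (\<lambda>p. q powi (\<bar>fst p\<bar> + \<bar>snd p\<bar>))"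
    using assms(1) by (auto simp: power_int_add)
  finally show ?thesis
    by (intro summable_on_dominated[where l = "\<lambda>p. \<bar>fst p\<bar> + \<bar>snd p\<bar>"]) (use assms in auto)
qed

text \<open>This is (|n| - 1)^2 \<ge> 0. The factor 2 leaves one |n| to spare against linear terms
  of the exponent.\<close>

lemma two_abs_le: "2 * \<bar>n\<bar> \<le> n\<^sup>2 + 1" for n :: int
  using zero_le_power2[of "\<bar>n\<bar> - 1"] by (simp add: power2_diff)

lemma abs_le_square: "\<bar>n\<bar> \<le> n\<^sup>2" for n :: int
proof (cases "n = 0")
  case False
  then have "\<bar>n\<bar> * 1 \<le> \<bar>n\<bar> * \<bar>n\<bar>" by (intro mult_left_mono) auto
  then show ?thesis by (simp add: power2_eq_square flip: abs_mult)
qed simp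

section \<open>Binary theta series\<close>

text \<open>\<open>theta (-1) q\<close> is the classical \<theta>(-q), since n and n^2 have the same
  parity. Keeping the sign apart lets q stay in (0, 1).\<close>

definition theta :: "real \<Rightarrow> real \<Rightarrow> real" where
  "theta s q = (\<Sum>\<^sub>\<infinity>n::int. s powi n * q powi n\<^sup>2)"

text \<open>The classical \<open>\<theta>\<^sub>2(q)\<close> is \<open>q^(1/4) psi q\<close>; the series below has integer exponents.\<close>

definition psi :: "real \<Rightarrow> real" where
  "psi q = (\<Sum>\<^sub>\<infinity>n::int. q powi (n\<^sup>2 + n))"

text \<open>\<open>hex 1\<close> is the cubic theta function a(q) of the Borweins; t = -1 twists it
  by the parity of y.\<close>

definition hex :: "real \<Rightarrow> real \<Rightarrow> real" where
  "hex t q = (\<Sum>\<^sub>\<infinity>(x, y). t powi y * q powi (x\<^sup>2 + x * y + y\<^sup>2))"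

lemma abs_sign_power_int: "\<bar>s\<bar> = 1 \<Longrightarrow> \<bar>s powi n\<bar> = (1 :: real)"
  by (simp add: power_int_abs)

lemma has_sum_theta:
  assumes "0 < q" "q < 1" "\<bar>s\<bar> = 1"
  shows "((\<lambda>n::int. s powi n * q powi n\<^sup>2) has_sum theta s q) UNIV"
  unfolding theta_def using assms
  by (intro has_sum_infsum summable_on_theta1[where c = 0]) (auto simp: abs_sign_power_int abs_le_square)

lemma has_sum_psi:
  assumes "0 < q" "q < 1"
  shows "((\<lambda>n::int. q powi (n\<^sup>2 + n)) has_sum psi q) UNIV"
proof -
  have "\<bar>n\<bar> \<le> n\<^sup>2 + n + 1" for n :: int using two_abs_le[of n] by linarith
  then have "(\<lambda>n::int. 1 * q powi (n\<^sup>2 + n)) summable_on UNIV"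
    using assms by (intro summable_on_theta1[where c = 1]) auto
  then show ?thesis unfolding psi_def by (intro has_sum_infsum) simp
qed

lemma has_sum_hex:
  assumes "0 < q" "q < 1" "\<bar>t\<bar> = 1"
  shows "((\<lambda>(x, y). t powi y * q powi (x\<^sup>2 + x * y + y\<^sup>2)) has_sum hex t q) UNIV"
proof -
  have "\<bar>x\<bar> + \<bar>y\<bar> \<le> x\<^sup>2 + x * y + y\<^sup>2 + 1" for x y :: int
    using two_abs_le[of x] two_abs_le[of y] zero_le_power2[of "x + y"] by (simp add: power2_sum)
  then have "(\<lambda>p. t powi (snd p) * q powi ((fst p)\<^sup>2 + fst p * snd p + (snd p)\<^sup>2)) summable_on UNIV"
    using assms by (intro summable_on_theta2[where c = 1]) (auto simp: abs_sign_power_int)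
  then show ?thesis unfolding hex_def by (intro has_sum_infsum) (simp add: case_prod_unfold)
qed

lemma has_sum_times:
  fixes f :: "'a \<Rightarrow> real" and g :: "'b \<Rightarrow> real"
  assumes "(f has_sum a) UNIV" "(g has_sum b) UNIV"
  shows "((\<lambda>(x, y). f x * g y) has_sum a * b) UNIV"
  using has_sum_times_real[of f UNIV g UNIV] assms
  by (simp add: has_sum_imp_summable infsumI)

lemma has_sum_split:
  fixes f :: "'a \<Rightarrow> real"
  assumes "(f has_sum a) UNIV"
  shows "(f has_sum infsum f {x. P x}) {x. P x}" "(f has_sum infsum f {x. \<not> P x}) {x. \<not> P x}"
    "infsum f {x. P x} + infsum f {x. \<not> P x} = a"
proof -
  show 1: "(f has_sum infsum f {x. P x}) {x. P x}" "(f has_sum infsum f {x. \<not> P x}) {x. \<not> P x}"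
    using summable_on_subset_banach[OF has_sum_imp_summable[OF assms]] by (auto intro!: has_sum_infsum)
  have "(f has_sum (infsum f {x. P x} + infsum f {x. \<not> P x})) ({x. P x} \<union> {x. \<not> P x})"
    by (rule has_sum_Un_disjoint[OF 1]) auto
  moreover have "{x. P x} \<union> {x. \<not> P x} = UNIV" by auto
  ultimately have "(f has_sum (infsum f {x. P x} + infsum f {x. \<not> P x})) UNIV" by simp
  from has_sum_unique[OF this assms] show "infsum f {x. P x} + infsum f {x. \<not> P x} = a" .
qed

text \<open>Half the sum and half the difference of a series and its twist by a sign isolate the two
  classes of indices.\<close>

lemma has_sum_split_sign:
  fixes f g :: "'a \<Rightarrow> real"
  assumes "(f has_sum a) UNIV" "(g has_sum b) UNIV" "\<And>x. P x \<Longrightarrow> g x = f x" "\<And>x. \<not> P x \<Longrightarrow> g x = - f x"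
  shows "(f has_sum ((a + b) / 2)) {x. P x}" "(f has_sum ((a - b) / 2)) {x. \<not> P x}"
proof -
  note s = has_sum_split[OF assms(1), of P]
  note t = has_sum_split[OF assms(2), of P]
  have "infsum g {x. P x} = infsum f {x. P x}" using assms(3) by (intro infsum_cong) auto
  moreover have "infsum g {x. \<not> P x} = infsum (\<lambda>x. - f x) {x. \<not> P x}"
    using assms(4) by (intro infsum_cong) auto
  then have "infsum g {x. \<not> P x} = - infsum f {x. \<not> P x}" by (simp add: infsum_uminus)
  ultimately have e: "infsum f {x. P x} = (a + b) / 2" "infsum f {x. \<not> P x} = (a - b) / 2"
    using s(3) t(3) by auto
  show "(f has_sum ((a + b) / 2)) {x. P x}" "(f has_sum ((a - b) / 2)) {x. \<not> P x}"
    using s(1,2) unfolding e .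
qed

section \<open>Parametrisations of the parity classes of pairs of integers\<close>

lemma bij_betw_UNIVI:
  assumes "inj j" "\<And>x. j x \<in> S" "\<And>y. y \<in> S \<Longrightarrow> \<exists>x. y = j x"
  shows "bij_betw j UNIV S"
  unfolding bij_betw_def using assms by blast

lemma bij_betw_even_sum:
  "bij_betw (\<lambda>(i, j). (i + j, i - j)) UNIV {x :: int \<times> int. even (fst x + snd x)}"
proof (rule bij_betw_UNIVI)
  fix y :: "int \<times> int" assume y: "y \<in> {x. even (fst x + snd x)}"
  then have "even (fst y + snd y)" by simp
  then obtain k where "fst y + snd y = 2 * k" by (elim evenE)
  then have "y = (case (k, fst y - k) of (i, j) \<Rightarrow> (i + j, i - j))" by (cases y) auto
  then show "\<exists>x. y = (case x of (i, j) \<Rightarrow> (i + j, i - j))" by blast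
qed (auto simp: inj_on_def)

lemma bij_betw_odd_sum:
  "bij_betw (\<lambda>(i, j). (i + j + 1, i - j)) UNIV {x :: int \<times> int. odd (fst x + snd x)}"
proof (rule bij_betw_UNIVI)
  fix y :: "int \<times> int" assume y: "y \<in> {x. odd (fst x + snd x)}"
  then have "odd (fst y + snd y)" by simp
  then obtain k where "fst y + snd y = 2 * k + 1" by (elim oddE)
  then have "y = (case (k, fst y - k - 1) of (i, j) \<Rightarrow> (i + j + 1, i - j))" by (cases y) auto
  then show "\<exists>x. y = (case x of (i, j) \<Rightarrow> (i + j + 1, i - j))" by blast
qed (auto simp: inj_on_def)

text \<open>In these coordinates m^2 + m + n^2 + n becomes 2 (i^2 + i) + 2 j^2, exactly as on the
  even class under \<open>bij_betw_even_sum\<close>.\<close>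

lemma bij_betw_odd_sum':
  "bij_betw (\<lambda>(i, j). (i + j, j - i - 1)) UNIV {x :: int \<times> int. odd (fst x + snd x)}"
proof (rule bij_betw_UNIVI)
  fix y :: "int \<times> int" assume y: "y \<in> {x. odd (fst x + snd x)}"
  then have "odd (fst y + snd y)" by simp
  then obtain k where "fst y + snd y = 2 * k + 1" by (elim oddE)
  then have "y = (case (fst y - k - 1, k + 1) of (i, j) \<Rightarrow> (i + j, j - i - 1))" by (cases y) auto
  then show "\<exists>x. y = (case x of (i, j) \<Rightarrow> (i + j, j - i - 1))" by blast
qed (auto simp: inj_on_def)

lemma bij_betw_even_sum_shear:
  "bij_betw (\<lambda>(x, y). (2 * x + y, y)) UNIV {x :: int \<times> int. even (fst x + snd x)}"
  "bij_betw (\<lambda>(x, y). (x - 2 * y, x)) UNIV {x :: int \<times> int. even (fst x + snd x)}"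
proof -
  show "bij_betw (\<lambda>(x, y). (2 * x + y, y)) UNIV {x :: int \<times> int. even (fst x + snd x)}"
  proof (rule bij_betw_UNIVI)
    fix y :: "int \<times> int" assume y: "y \<in> {x. even (fst x + snd x)}"
    then have "even (fst y + snd y)" by simp
  then obtain k where "fst y + snd y = 2 * k" by (elim evenE)
    then have "y = (case (k - snd y, snd y) of (x, y) \<Rightarrow> (2 * x + y, y))" by (cases y) auto
    then show "\<exists>x. y = (case x of (x, y) \<Rightarrow> (2 * x + y, y))" by blast
  qed (auto simp: inj_on_def)
  show "bij_betw (\<lambda>(x, y). (x - 2 * y, x)) UNIV {x :: int \<times> int. even (fst x + snd x)}"
  proof (rule bij_betw_UNIVI)
    fix y :: "int \<times> int" assume y: "y \<in> {x. even (fst x + snd x)}"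
    then have "even (fst y + snd y)" by simp
  then obtain k where "fst y + snd y = 2 * k" by (elim evenE)
    then have "y = (case (snd y, snd y - k) of (x, y) \<Rightarrow> (x - 2 * y, x))" by (cases y) auto
    then show "\<exists>x. y = (case x of (x, y) \<Rightarrow> (x - 2 * y, x))" by blast
  qed (auto simp: inj_on_def)
qed

lemma bij_betw_odd_sum_shear:
  "bij_betw (\<lambda>(x, y). (2 * x + 1 - y, y)) UNIV {x :: int \<times> int. odd (fst x + snd x)}"
proof (rule bij_betw_UNIVI)
  fix y :: "int \<times> int" assume y: "y \<in> {x. odd (fst x + snd x)}"
  then have "odd (fst y + snd y)" by simp
  then obtain k where "fst y + snd y = 2 * k + 1" by (elim oddE)
  then have "y = (case (k, snd y) of (x, y) \<Rightarrow> (2 * x + 1 - y, y))" by (cases y) auto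
  then show "\<exists>x. y = (case x of (x, y) \<Rightarrow> (2 * x + 1 - y, y))" by blast
qed (auto simp: inj_on_def)

lemma bij_betw_even_snd:
  "bij_betw (\<lambda>(x, y). (x - y, 2 * y)) UNIV {x :: int \<times> int. even (snd x)}"
proof (rule bij_betw_UNIVI)
  fix y :: "int \<times> int" assume y: "y \<in> {x. even (snd x)}"
  then have "even (snd y)" by simp
  then obtain k where "snd y = 2 * k" by (elim evenE)
  then have "y = (case (fst y + k, k) of (x, y) \<Rightarrow> (x - y, 2 * y))" by (cases y) auto
  then show "\<exists>x. y = (case x of (x, y) \<Rightarrow> (x - y, 2 * y))" by blast
qed (auto simp: inj_on_def)

lemma bij_betw_odd_snd:
  "bij_betw (\<lambda>(x, y). (x - y, 2 * y + 1)) UNIV {x :: int \<times> int. odd (snd x)}"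
proof (rule bij_betw_UNIVI)
  fix y :: "int \<times> int" assume y: "y \<in> {x. odd (snd x)}"
  then have "odd (snd y)" by simp
  then obtain k where "snd y = 2 * k + 1" by (elim oddE)
  then have "y = (case (fst y + k, k) of (x, y) \<Rightarrow> (x - y, 2 * y + 1))" by (cases y) auto
  then show "\<exists>x. y = (case x of (x, y) \<Rightarrow> (x - y, 2 * y + 1))" by blast
qed (auto simp: inj_on_def)

lemma has_sum_reparam:
  fixes f :: "'b \<Rightarrow> real"
  assumes "bij_betw j UNIV S" "(g has_sum a) UNIV" "\<And>x. g x = f (j x)"
  shows "(f has_sum a) S"
proof -
  have "g = (\<lambda>x. f (j x))" using assms(3) by auto
  then show ?thesis using has_sum_reindex_bij_betw[OF assms(1), of f a] assms(2) by simp
qed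

lemma sign_sum_even: "even (m + n) \<Longrightarrow> (-1) powi m * (-1) powi n = (1 :: real)"
  and sign_sum_odd: "odd (m + n) \<Longrightarrow> (-1) powi m * (-1) powi n = (-1 :: real)" for m n :: int
  by (auto simp: power_int_minus_left)

lemma power_less_one:
  fixes q :: real
  assumes "0 < q" "q < 1" "0 < n"
  shows "0 < q ^ n" "q ^ n < 1"
  using assms by (auto simp: power_less_one_iff)

section \<open>Relations between theta values at q, q^2, q^3 and q^4\<close>

context
  fixes q :: real
  assumes q: "0 < q" "q < 1"
begin

lemma has_sum_squares:
  "((\<lambda>(m, n). q powi (m\<^sup>2 + n\<^sup>2)) has_sum (((theta 1 q)\<^sup>2 + (theta (-1) q)\<^sup>2) / 2)) {x. even (fst x + snd x)}"
  "((\<lambda>(m, n). q powi (m\<^sup>2 + n\<^sup>2)) has_sum (((theta 1 q)\<^sup>2 - (theta (-1) q)\<^sup>2) / 2)) {x. odd (fst x + snd x)}"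
proof -
  define f :: "int \<times> int \<Rightarrow> real" where "f = (\<lambda>(m, n). q powi (m\<^sup>2 + n\<^sup>2))"
  define g :: "int \<times> int \<Rightarrow> real" where "g = (\<lambda>(m, n). ((-1) powi m * (-1) powi n) * q powi (m\<^sup>2 + n\<^sup>2))"
  have f: "(f has_sum (theta 1 q)\<^sup>2) UNIV"
    using has_sum_times[OF has_sum_theta has_sum_theta, of q 1 q 1] q
    by (simp add: f_def power_int_add power2_eq_square[of "theta _ _"])
  have g: "(g has_sum (theta (-1) q)\<^sup>2) UNIV"
    using has_sum_times[OF has_sum_theta has_sum_theta, of q "-1" q "-1"] q
    by (simp add: g_def power_int_add power2_eq_square[of "theta _ _"] mult_ac)
  show "(f has_sum (((theta 1 q)\<^sup>2 + (theta (-1) q)\<^sup>2) / 2)) {x. even (fst x + snd x)}"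
    "(f has_sum (((theta 1 q)\<^sup>2 - (theta (-1) q)\<^sup>2) / 2)) {x. odd (fst x + snd x)}"
    by (rule has_sum_split_sign[OF f g]; auto simp: f_def g_def sign_sum_even sign_sum_odd)+
qed

lemma mult_power_int: "q * q powi k = q powi (k + 1)"
  using q by (simp add: power_int_add_1')

text \<open>Pairs with even sum form the square lattice rotated by 45 degrees: (i + j)^2 + (i - j)^2
  = 2 i^2 + 2 j^2.\<close>

lemma theta_squares_add: "(theta 1 q)\<^sup>2 + (theta (-1) q)\<^sup>2 = 2 * (theta 1 (q\<^sup>2))\<^sup>2"
proof -
  have "((\<lambda>(m, n). q powi (m\<^sup>2 + n\<^sup>2)) has_sum theta 1 (q\<^sup>2) * theta 1 (q\<^sup>2)) {x. even (fst x + snd x)}"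
  proof (rule has_sum_reparam[OF bij_betw_even_sum has_sum_times[OF has_sum_theta has_sum_theta]])
    fix x :: "int \<times> int"
    obtain i j where x: "x = (i, j)" by force
    show "(case x of (i, j) \<Rightarrow> 1 powi i * (q\<^sup>2) powi i\<^sup>2 * (1 powi j * (q\<^sup>2) powi j\<^sup>2)) =
        (case case x of (i, j) \<Rightarrow> (i + j, i - j) of (m, n) \<Rightarrow> q powi (m\<^sup>2 + n\<^sup>2))"
      using q by (simp add: x power_int_power flip: power_int_add; simp add: power2_eq_square algebra_simps)
  qed (use power_less_one[OF q, of 2] q in auto)
  from has_sum_unique[OF has_sum_squares(1) this] show ?thesis by (simp add: power2_eq_square)
qed

text \<open>On the odd class (i + j + 1)^2 + (i - j)^2 = 1 + 2 (i^2 + i) + 2 (j^2 + j), which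
  produces the factor q and the two \<open>psi\<close>.\<close>

lemma theta_squares_diff: "(theta 1 q)\<^sup>2 - (theta (-1) q)\<^sup>2 = 2 * q * (psi (q\<^sup>2))\<^sup>2"
proof -
  have "((\<lambda>(m, n). q powi (m\<^sup>2 + n\<^sup>2)) has_sum q * (psi (q\<^sup>2) * psi (q\<^sup>2))) {x. odd (fst x + snd x)}"
  proof (rule has_sum_reparam[OF bij_betw_odd_sum has_sum_cmult_right[OF has_sum_times[OF has_sum_psi has_sum_psi]]])
    fix x :: "int \<times> int"
    obtain i j where x: "x = (i, j)" by force
    show "q * (case x of (i, j) \<Rightarrow> (q\<^sup>2) powi (i\<^sup>2 + i) * (q\<^sup>2) powi (j\<^sup>2 + j)) =
        (case case x of (i, j) \<Rightarrow> (i + j + 1, i - j) of (m, n) \<Rightarrow> q powi (m\<^sup>2 + n\<^sup>2))"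
      using q by (simp add: x power_int_power mult_power_int flip: power_int_add; simp add: power2_eq_square algebra_simps)
  qed (use power_less_one[OF q, of 2] q in auto)
  from has_sum_unique[OF has_sum_squares(2) this] show ?thesis by (simp add: power2_eq_square)
qed

text \<open>The even and the odd class of index pairs contribute the same product, hence the factor
  2.\<close>

lemma psi_square: "(psi q)\<^sup>2 = 2 * theta 1 (q\<^sup>2) * psi (q\<^sup>2)"
proof -
  let ?f = "\<lambda>(m, n). q powi (m\<^sup>2 + m) * q powi (n\<^sup>2 + n)"
  have tot: "(?f has_sum psi q * psi q) UNIV"
    using q by (intro has_sum_times has_sum_psi)
  have q2: "0 < q\<^sup>2" "q\<^sup>2 < 1" using power_less_one[OF q, of 2] by auto
  note src = has_sum_times[OF has_sum_psi has_sum_theta[of "q\<^sup>2" 1], OF q2 q2, simplified]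
  have "(?f has_sum psi (q\<^sup>2) * theta 1 (q\<^sup>2)) {x. even (fst x + snd x)}"
  proof (rule has_sum_reparam[OF bij_betw_even_sum src])
    fix x :: "int \<times> int"
    obtain i j where x: "x = (i, j)" by force
    show "(case x of (i, j) \<Rightarrow> (q\<^sup>2) powi (i\<^sup>2 + i) * (q\<^sup>2) powi j\<^sup>2) = ?f (case x of (i, j) \<Rightarrow> (i + j, i - j))"
      using q by (simp add: x power_int_power flip: power_int_add; simp add: power2_eq_square algebra_simps)
  qed
  moreover have "(?f has_sum psi (q\<^sup>2) * theta 1 (q\<^sup>2)) {x. odd (fst x + snd x)}"
  proof (rule has_sum_reparam[OF bij_betw_odd_sum' src])
    fix x :: "int \<times> int"
    obtain i j where x: "x = (i, j)" by force
    show "(case x of (i, j) \<Rightarrow> (q\<^sup>2) powi (i\<^sup>2 + i) * (q\<^sup>2) powi j\<^sup>2) = ?f (case x of (i, j) \<Rightarrow> (i + j, j - i - 1))"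
      using q by (simp add: x power_int_power flip: power_int_add; simp add: power2_eq_square algebra_simps)
  qed
  ultimately have "(?f has_sum (psi (q\<^sup>2) * theta 1 (q\<^sup>2) + psi (q\<^sup>2) * theta 1 (q\<^sup>2)))
      ({x. even (fst x + snd x)} \<union> {x. odd (fst x + snd x)})"
    by (rule has_sum_Un_disjoint) auto
  moreover have "{x :: int \<times> int. even (fst x + snd x)} \<union> {x. odd (fst x + snd x)} = UNIV" by auto
  ultimately show ?thesis using has_sum_unique[OF tot] by (simp add: power2_eq_square)
qed

text \<open>The third exponent is (m + 1/2)^2 + 3 (n + 1/2)^2, so this series runs over the
  half-integral points of X^2 + 3 Y^2.\<close>

lemma has_sum_theta_cube_arg:
  "((\<lambda>(m, n). q powi (m\<^sup>2 + 3 * n\<^sup>2)) has_sum theta 1 q * theta 1 (q ^ 3)) UNIV"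
  "((\<lambda>(m, n). ((-1) powi m * (-1) powi n) * q powi (m\<^sup>2 + 3 * n\<^sup>2)) has_sum theta (-1) q * theta (-1) (q ^ 3)) UNIV"
  "((\<lambda>(m, n). q powi (m\<^sup>2 + m + 3 * n\<^sup>2 + 3 * n + 1)) has_sum q * (psi q * psi (q ^ 3))) UNIV"
proof -
  have q3: "0 < q ^ 3" "q ^ 3 < 1" using power_less_one[OF q, of 3] by auto
  show "((\<lambda>(m, n). q powi (m\<^sup>2 + 3 * n\<^sup>2)) has_sum theta 1 q * theta 1 (q ^ 3)) UNIV"
    using has_sum_times[OF has_sum_theta[of q 1] has_sum_theta[of "q ^ 3" 1]] q q3
    by (simp add: power_int_power power_int_add)
  show "((\<lambda>(m, n). ((-1) powi m * (-1) powi n) * q powi (m\<^sup>2 + 3 * n\<^sup>2)) has_sum theta (-1) q * theta (-1) (q ^ 3)) UNIV"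
    using has_sum_times[OF has_sum_theta[of q "-1"] has_sum_theta[of "q ^ 3" "-1"]] q q3
    by (simp add: power_int_power power_int_add mult_ac)
  have "q * (q powi (m\<^sup>2 + m) * (q ^ 3) powi (n\<^sup>2 + n)) = q powi (m\<^sup>2 + m + 3 * n\<^sup>2 + 3 * n + 1)" for m n
    using q by (simp add: power_int_power mult_power_int flip: power_int_add; simp add: algebra_simps)
  then show "((\<lambda>(m, n). q powi (m\<^sup>2 + m + 3 * n\<^sup>2 + 3 * n + 1)) has_sum q * (psi q * psi (q ^ 3))) UNIV"
    using has_sum_cmult_right[OF has_sum_times[OF has_sum_psi[of q] has_sum_psi[of "q ^ 3"]], of q] q q3
    by (simp add: case_prod_unfold)
qed

text \<open>Completing the square, the vectors with even y are the integral points of X^2 + 3 Y^2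
  and those with odd y the half-integral ones; t = -1 changes the sign of the latter.\<close>

lemma hex_eq:
  "hex 1 q = theta 1 q * theta 1 (q ^ 3) + q * (psi q * psi (q ^ 3))"
  "hex (-1) q = theta 1 q * theta 1 (q ^ 3) - q * (psi q * psi (q ^ 3))"
proof -
  let ?f = "\<lambda>(x, y). 1 powi y * q powi (x\<^sup>2 + x * y + y\<^sup>2)"
  note s = has_sum_split_sign[of ?f "hex 1 q", OF has_sum_hex[of q 1] has_sum_hex[of q "-1"], of "\<lambda>x. even (snd x)"]
  have e: "(?f has_sum ((hex 1 q + hex (-1) q) / 2)) {x. even (snd x)}"
    and o: "(?f has_sum ((hex 1 q - hex (-1) q) / 2)) {x. odd (snd x)}"
    using q by (intro s; auto simp: power_int_minus_left)+
  have "(?f has_sum (theta 1 q * theta 1 (q ^ 3))) {x. even (snd x)}"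
  proof (rule has_sum_reparam[OF bij_betw_even_snd has_sum_theta_cube_arg(1)])
    fix x :: "int \<times> int"
    obtain i j where x: "x = (i, j)" by force
    show "(case x of (m, n) \<Rightarrow> q powi (m\<^sup>2 + 3 * n\<^sup>2)) = ?f (case x of (x, y) \<Rightarrow> (x - y, 2 * y))"
      by (simp add: x; simp add: power2_eq_square algebra_simps)
  qed
  moreover have "(?f has_sum (q * (psi q * psi (q ^ 3)))) {x. odd (snd x)}"
  proof (rule has_sum_reparam[OF bij_betw_odd_snd has_sum_theta_cube_arg(3)])
    fix x :: "int \<times> int"
    obtain i j where x: "x = (i, j)" by force
    show "(case x of (m, n) \<Rightarrow> q powi (m\<^sup>2 + m + 3 * n\<^sup>2 + 3 * n + 1)) = ?f (case x of (x, y) \<Rightarrow> (x - y, 2 * y + 1))"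
      by (simp add: x; simp add: power2_eq_square algebra_simps)
  qed
  ultimately have "(hex 1 q + hex (-1) q) / 2 = theta 1 q * theta 1 (q ^ 3)"
    "(hex 1 q - hex (-1) q) / 2 = q * (psi q * psi (q ^ 3))"
    using has_sum_unique[OF e] has_sum_unique[OF o] by auto
  then show "hex 1 q = theta 1 q * theta 1 (q ^ 3) + q * (psi q * psi (q ^ 3))"
    "hex (-1) q = theta 1 q * theta 1 (q ^ 3) - q * (psi q * psi (q ^ 3))"
    by (simp_all add: field_simps)
qed

text \<open>
  A rotation of order 6 of the hexagonal lattice maps the integral points of \<open>X\<^sup>2 + 3 Y\<^sup>2\<close> with \<open>X + Y\<close> odd
  onto one of the two classes of half-integral points; these classes are conjugate under \<open>Y \<mapsto> - Y\<close>.
\<close>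

lemma theta_cubic_modular_equation:
  "theta 1 q * theta 1 (q ^ 3) = theta (-1) q * theta (-1) (q ^ 3) + q * (psi q * psi (q ^ 3))" (is ?A)
  and hex_power4:
  "2 * hex 1 (q ^ 4) = theta 1 q * theta 1 (q ^ 3) + theta (-1) q * theta (-1) (q ^ 3)" (is ?B)
proof -
  let ?f = "\<lambda>(m, n). q powi (m\<^sup>2 + 3 * n\<^sup>2)"
  let ?h = "\<lambda>(m, n). q powi (m\<^sup>2 + m + 3 * n\<^sup>2 + 3 * n + 1)"
  note s = has_sum_split_sign[OF has_sum_theta_cube_arg(1,2), of "\<lambda>x. even (fst x + snd x)"]
  have e: "(?f has_sum ((theta 1 q * theta 1 (q ^ 3) + theta (-1) q * theta (-1) (q ^ 3)) / 2)) {x. even (fst x + snd x)}"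
    and o: "(?f has_sum ((theta 1 q * theta 1 (q ^ 3) - theta (-1) q * theta (-1) (q ^ 3)) / 2)) {x. odd (fst x + snd x)}"
    by (rule s; auto simp: sign_sum_even sign_sum_odd)+
  \<comment> \<open>The even class is a hexagonal lattice scaled by 2: (2 x + y)^2 + 3 y^2 = 4 (x^2
    + x y + y^2).\<close>
  have "(?f has_sum hex 1 (q ^ 4)) {x. even (fst x + snd x)}"
  proof (rule has_sum_reparam[OF bij_betw_even_sum_shear(1) has_sum_hex])
    fix x :: "int \<times> int"
    obtain i j where x: "x = (i, j)" by force
    show "(case x of (x, y) \<Rightarrow> 1 powi y * (q ^ 4) powi (x\<^sup>2 + x * y + y\<^sup>2)) = ?f (case x of (x, y) \<Rightarrow> (2 * x + y, y))"
      by (simp add: x power_int_power; simp add: power2_eq_square algebra_simps)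
  qed (use power_less_one[OF q, of 4] q in auto)
  with has_sum_unique[OF e] show ?B by simp
  have "infsum ?h {x. even (fst x + snd x)} = infsum ?h {x. odd (fst x + snd x)}"
    by (rule infsum_reindex_bij_witness[of _ "\<lambda>(m, n). (m, - 1 - n)" "\<lambda>(m, n). (m, - 1 - n)"])
       (auto simp: power2_eq_square algebra_simps)
  moreover note h = has_sum_split[OF has_sum_theta_cube_arg(3), of "\<lambda>x. even (fst x + snd x)"]
  ultimately have "infsum ?h {x. even (fst x + snd x)} = q * (psi q * psi (q ^ 3)) / 2" by linarith
  with h(1) have heven: "(?h has_sum (q * (psi q * psi (q ^ 3)) / 2)) {x. even (fst x + snd x)}" by (simp only:)
  have "(?h has_sum ((theta 1 q * theta 1 (q ^ 3) - theta (-1) q * theta (-1) (q ^ 3)) / 2)) {x. even (fst x + snd x)}"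
  proof (rule has_sum_reparam[OF bij_betw_even_sum_shear(2)])
    show "((\<lambda>x. ?f (case x of (x, y) \<Rightarrow> (2 * x + 1 - y, y))) has_sum
        ((theta 1 q * theta 1 (q ^ 3) - theta (-1) q * theta (-1) (q ^ 3)) / 2)) UNIV"
      using o has_sum_reindex_bij_betw[OF bij_betw_odd_sum_shear] by blast
    fix x :: "int \<times> int"
    obtain i j where x: "x = (i, j)" by force
    show "?f (case x of (x, y) \<Rightarrow> (2 * x + 1 - y, y)) = ?h (case x of (x, y) \<Rightarrow> (x - 2 * y, x))"
      by (simp add: x; simp add: power2_eq_square algebra_simps)
  qed
  from has_sum_unique[OF this heven] show ?A by simp
qed

end

section \<open>Ternary theta series and residues modulo 3\<close>

text \<open>The exponent is ((3 z + 1)^2 - 1) / 3: up to a constant, the contribution of the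
  direction (1, 1, 1) for triples with coordinate sum 3 z + 1.\<close>

definition theta_third :: "real \<Rightarrow> real \<Rightarrow> real" where
  "theta_third s q = (\<Sum>\<^sub>\<infinity>z::int. s powi z * q powi (3 * z\<^sup>2 + 2 * z))"

text \<open>A translate of the hexagonal lattice: the triples (y, x, 1 - x - y) in the plane of
  coordinate sum 1. The sign exponent 1 - y is the sum of the last two coordinates.\<close>

definition hex_third :: "real \<Rightarrow> real \<Rightarrow> real" where
  "hex_third t q = (\<Sum>\<^sub>\<infinity>(x, y). t powi (1 - y) * q powi (x\<^sup>2 + y\<^sup>2 + (1 - x - y)\<^sup>2))"

lemma has_sum_theta_third:
  assumes "0 < q" "q < 1" "\<bar>s\<bar> = 1"
  shows "((\<lambda>z::int. s powi z * q powi (3 * z\<^sup>2 + 2 * z)) has_sum theta_third s q) UNIV"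
proof -
  have "\<bar>n\<bar> \<le> 3 * n\<^sup>2 + 2 * n + 3" for n :: int
    using two_abs_le[of n] by linarith
  then show ?thesis unfolding theta_third_def using assms
    by (intro has_sum_infsum summable_on_theta1[where c = 3]) (auto simp: abs_sign_power_int)
qed

lemma has_sum_hex_third:
  assumes "0 < q" "q < 1" "\<bar>t\<bar> = 1"
  shows "((\<lambda>(x, y). t powi (1 - y) * q powi (x\<^sup>2 + y\<^sup>2 + (1 - x - y)\<^sup>2)) has_sum hex_third t q) UNIV"
proof -
  have "\<bar>x\<bar> + \<bar>y\<bar> \<le> x\<^sup>2 + y\<^sup>2 + (1 - x - y)\<^sup>2 + 2" for x y :: int
    using two_abs_le[of x] two_abs_le[of y] zero_le_power2[of "1 - x - y"] by linarith
  then have "(\<lambda>p. t powi (1 - snd p) * q powi ((fst p)\<^sup>2 + (snd p)\<^sup>2 + (1 - fst p - snd p)\<^sup>2)) summable_on UNIV"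
    using assms by (intro summable_on_theta2[where c = 2]) (auto simp: abs_sign_power_int)
  then show ?thesis unfolding hex_third_def by (intro has_sum_infsum) (simp add: case_prod_unfold)
qed

lemma sign_power_int_minus: "s = 1 \<or> s = -1 \<Longrightarrow> s powi (- n) = (s powi n :: real)"
  by (auto simp: power_int_minus_one_minus)

text \<open>Subtracting z (1, 1, 1) leaves a triple of coordinate sum 0 or 1. The third map is the
  negative of the second, since negation exchanges the residues 1 and 2.\<close>

lemma bij_betw_sum_mod_3:
  "bij_betw (\<lambda>(z, x, y). (z + y, z + x, z - x - y)) UNIV {(u, v, w). (u + v + w) mod 3 = (0 :: int)}"
  "bij_betw (\<lambda>(z, x, y). (z + y, z + x, z + 1 - x - y)) UNIV {(u, v, w). (u + v + w) mod 3 = (1 :: int)}"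
  "bij_betw (\<lambda>(z, x, y). (- z - y, - z - x, x + y - z - 1)) UNIV {(u, v, w). (u + v + w) mod 3 = (2 :: int)}"
proof -
  show "bij_betw (\<lambda>(z, x, y). (z + y, z + x, z - x - y)) UNIV {(u, v, w). (u + v + w) mod 3 = (0 :: int)}"
  proof (rule bij_betw_UNIVI)
    fix p :: "int \<times> int \<times> int" assume "p \<in> {(u, v, w). (u + v + w) mod 3 = 0}"
    then obtain u v w k where "p = (u, v, w)" "u + v + w = 3 * k" by (cases p) auto
    then have "p = (case (k, v - k, u - k) of (z, x, y) \<Rightarrow> (z + y, z + x, z - x - y))" by auto
    then show "\<exists>x. p = (case x of (z, x, y) \<Rightarrow> (z + y, z + x, z - x - y))" by blast
  qed (auto simp: inj_on_def)
  show "bij_betw (\<lambda>(z, x, y). (z + y, z + x, z + 1 - x - y)) UNIV {(u, v, w). (u + v + w) mod 3 = (1 :: int)}"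
  proof (rule bij_betw_UNIVI)
    fix p :: "int \<times> int \<times> int" assume "p \<in> {(u, v, w). (u + v + w) mod 3 = 1}"
    then obtain u v w where p: "p = (u, v, w)" "(u + v + w) mod 3 = 1" by auto
    then have "u + v + w = 3 * ((u + v + w) div 3) + 1" by presburger
    then obtain k where "u + v + w = 3 * k + 1" by blast
    with p have "p = (case (k, v - k, u - k) of (z, x, y) \<Rightarrow> (z + y, z + x, z + 1 - x - y))" by auto
    then show "\<exists>x. p = (case x of (z, x, y) \<Rightarrow> (z + y, z + x, z + 1 - x - y))" by blast
  next
    fix p :: "int \<times> int \<times> int"
    obtain z x y where p: "p = (z, x, y)" by (cases p)
    have "z + y + (z + x) + (z + 1 - x - y) = 1 + z * 3" by simp
    then show "(case p of (z, x, y) \<Rightarrow> (z + y, z + x, z + 1 - x - y)) \<in> {(u, v, w). (u + v + w) mod 3 = 1}"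
      unfolding p prod.case mem_Collect_eq by (simp only: mod_mult_self1) simp
  qed (auto simp: inj_on_def)
  show "bij_betw (\<lambda>(z, x, y). (- z - y, - z - x, x + y - z - 1)) UNIV {(u, v, w). (u + v + w) mod 3 = (2 :: int)}"
  proof (rule bij_betw_UNIVI)
    fix p :: "int \<times> int \<times> int" assume "p \<in> {(u, v, w). (u + v + w) mod 3 = 2}"
    then obtain u v w where p: "p = (u, v, w)" "(u + v + w) mod 3 = 2" by auto
    then have "u + v + w = 3 * ((u + v + w) div 3) + 2" by presburger
    then obtain k where "u + v + w = 3 * k + 2" by blast
    \<comment> \<open>The negated triple has sum - (3 k + 2) = 3 (- k - 1) + 1, hence z = - k -
      1.\<close>
    with p have "p = (case (- k - 1, k + 1 - v, k + 1 - u) of (z, x, y) \<Rightarrow> (- z - y, - z - x, x + y - z - 1))" by auto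
    then show "\<exists>x. p = (case x of (z, x, y) \<Rightarrow> (- z - y, - z - x, x + y - z - 1))" by blast
  next
    fix p :: "int \<times> int \<times> int"
    obtain z x y where p: "p = (z, x, y)" by (cases p)
    have "- z - y + (- z - x) + (x + y - z - 1) = 2 + (- z - 1) * 3" by simp
    then show "(case p of (z, x, y) \<Rightarrow> (- z - y, - z - x, x + y - z - 1)) \<in> {(u, v, w). (u + v + w) mod 3 = 2}"
      unfolding p prod.case mem_Collect_eq by (simp only: mod_mult_self1) simp
  qed (auto simp: inj_on_def)
qed

context
  fixes q :: real
  assumes q: "0 < q" "q < 1"
begin

lemma has_sum_theta_triple:
  assumes "\<bar>s\<bar> = 1" "\<bar>t\<bar> = 1"
  shows "((\<lambda>(u, v, w). s powi u * (t powi v * t powi w) * q powi (u\<^sup>2 + v\<^sup>2 + w\<^sup>2))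
    has_sum theta s q * (theta t q)\<^sup>2) UNIV"
proof -
  have "((\<lambda>(u, p). (s powi u * q powi u\<^sup>2) * (case p of (v, w) \<Rightarrow> t powi v * q powi v\<^sup>2 * (t powi w * q powi w\<^sup>2)))
    has_sum theta s q * (theta t q * theta t q)) UNIV"
    using q assms by (intro has_sum_times has_sum_theta)
  also have "(\<lambda>(u, p). (s powi u * q powi u\<^sup>2) * (case p of (v, w) \<Rightarrow> t powi v * q powi v\<^sup>2 * (t powi w * q powi w\<^sup>2)))
      = (\<lambda>(u, v, w). s powi u * (t powi v * t powi w) * q powi (u\<^sup>2 + v\<^sup>2 + w\<^sup>2))"
    using q by (auto simp: power_int_add)
  finally show ?thesis by (simp add: power2_eq_square)
qed

text \<open>The norm splits as 3 z^2 + 2 (x^2 + x y + y^2). With signs s, s t, s t the total sign is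
  s^(u+v+w) t^(v+w), which here is s^z t^y and so separates as well.\<close>

lemma has_sum_theta_triple_mod_0:
  assumes "s = 1 \<or> s = -1" "t = 1 \<or> t = -1"
  shows "((\<lambda>(u, v, w). s powi u * ((s * t) powi v * (s * t) powi w) * q powi (u\<^sup>2 + v\<^sup>2 + w\<^sup>2))
    has_sum theta s (q ^ 3) * hex t (q\<^sup>2)) {(u, v, w). (u + v + w) mod 3 = 0}" (is "(?f has_sum _) _")
proof (rule has_sum_reparam[OF bij_betw_sum_mod_3(1) has_sum_times[OF has_sum_theta has_sum_hex]])
  fix p :: "int \<times> int \<times> int"
  obtain z x y where p: "p = (z, x, y)" by (cases p)
  have e: "s powi (z + y) * ((s * t) powi (z + x) * (s * t) powi (z - x - y)) = s powi z * t powi y"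
    using assms by (auto simp: power_int_minus_left)
  have "3 * z\<^sup>2 + 2 * (x\<^sup>2 + x * y + y\<^sup>2) = (z + y)\<^sup>2 + (z + x)\<^sup>2 + (z - x - y)\<^sup>2"
    by (simp add: power2_eq_square algebra_simps)
  then have "q powi ((z + y)\<^sup>2 + (z + x)\<^sup>2 + (z - x - y)\<^sup>2) = q powi (3 * z\<^sup>2) * q powi (2 * (x\<^sup>2 + x * y + y\<^sup>2))"
    using q by (simp flip: power_int_add)
  then show "(case p of (z, p) \<Rightarrow> s powi z * (q ^ 3) powi z\<^sup>2 * (case p of (x, y) \<Rightarrow> t powi y * (q\<^sup>2) powi (x\<^sup>2 + x * y + y\<^sup>2)))
      = ?f (case p of (z, x, y) \<Rightarrow> (z + y, z + x, z - x - y))"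
    by (simp add: p e power_int_power mult_ac)
qed (use power_less_one[OF q, of 2] power_less_one[OF q, of 3] q assms in auto)

text \<open>The same splitting with u + v + w = 3 z + 1 yields one extra factor s. Residue 2 has the
  same sum because the summand is invariant under negating the triple.\<close>

lemma has_sum_theta_triple_mod_12:
  assumes "s = 1 \<or> s = -1" "t = 1 \<or> t = -1"
  defines "f \<equiv> \<lambda>(u, v, w). s powi u * ((s * t) powi v * (s * t) powi w) * q powi (u\<^sup>2 + v\<^sup>2 + w\<^sup>2)"
  shows "(f has_sum s * (theta_third s q * hex_third t q)) {(u, v, w). (u + v + w) mod 3 = 1}"
    and "(f has_sum s * (theta_third s q * hex_third t q)) {(u, v, w). (u + v + w) mod 3 = 2}"
proof -
  have st: "\<bar>s\<bar> = 1" "\<bar>t\<bar> = 1" using assms by auto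
  note src = has_sum_cmult_right[OF has_sum_times[OF has_sum_theta_third[OF q st(1)] has_sum_hex_third[OF q st(2)]], of s]
  have Q: "q powi ((z + y)\<^sup>2 + (z + x)\<^sup>2 + (z + 1 - x - y)\<^sup>2) = q powi (3 * z\<^sup>2 + 2 * z) * q powi (x\<^sup>2 + y\<^sup>2 + (1 - x - y)\<^sup>2)" for x y z :: int
  proof -
    have "3 * z\<^sup>2 + 2 * z + (x\<^sup>2 + y\<^sup>2 + (1 - x - y)\<^sup>2) = (z + y)\<^sup>2 + (z + x)\<^sup>2 + (z + 1 - x - y)\<^sup>2"
      by (simp add: power2_eq_square algebra_simps)
    then show ?thesis using q by (simp flip: power_int_add)
  qed
  have e: "s powi (z + y) * ((s * t) powi (z + x) * (s * t) powi (z + 1 - x - y)) = s * (s powi z * t powi (1 - y))" for x y z :: int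
    using assms by (auto simp: power_int_minus_left)
  have f: "f (z + y, z + x, z + 1 - x - y) =
      s * (s powi z * q powi (3 * z\<^sup>2 + 2 * z) * (t powi (1 - y) * q powi (x\<^sup>2 + y\<^sup>2 + (1 - x - y)\<^sup>2)))" for x y z :: int
    by (simp add: f_def e Q mult_ac)
  show "(f has_sum s * (theta_third s q * hex_third t q)) {(u, v, w). (u + v + w) mod 3 = 1}"
    by (rule has_sum_reparam[OF bij_betw_sum_mod_3(2) src]) (auto simp: f)
  have f': "f (- u, - v, - w) = f (u, v, w)" for u v w
  proof -
    have "s * t = 1 \<or> s * t = -1" using assms by auto
    then show ?thesis using assms(1,2) by (simp add: f_def sign_power_int_minus)
  qed
  have "f (- z - y, - z - x, x + y - z - 1) = f (z + y, z + x, z + 1 - x - y)" for x y z :: int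
  proof -
    have "(- z - y, - z - x, x + y - z - 1) = (- (z + y), - (z + x), - (z + 1 - x - y))" by simp
    then show ?thesis by (simp only: f')
  qed
  then show "(f has_sum s * (theta_third s q * hex_third t q)) {(u, v, w). (u + v + w) mod 3 = 2}"
    by (intro has_sum_reparam[OF bij_betw_sum_mod_3(3) src]) (auto simp: f)
qed

lemma theta_triple_eq:
  assumes "s = 1 \<or> s = -1" "t = 1 \<or> t = -1"
  shows "theta s q * (theta (s * t) q)\<^sup>2 = theta s (q ^ 3) * hex t (q\<^sup>2) + 2 * s * theta_third s q * hex_third t q"
proof -
  define f where "f = (\<lambda>(u, v, w). s powi u * ((s * t) powi v * (s * t) powi w) * q powi (u\<^sup>2 + v\<^sup>2 + w\<^sup>2))"
  define S :: "int \<Rightarrow> (int \<times> int \<times> int) set" where "S r = {(u, v, w). (u + v + w) mod 3 = r}" for r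
  have "(f has_sum (theta s (q ^ 3) * hex t (q\<^sup>2) + s * (theta_third s q * hex_third t q))) (S 0 \<union> S 1)"
    using has_sum_theta_triple_mod_0[OF assms] has_sum_theta_triple_mod_12(1)[OF assms]
    unfolding f_def S_def by (rule has_sum_Un_disjoint) auto
  then have "(f has_sum (theta s (q ^ 3) * hex t (q\<^sup>2) + s * (theta_third s q * hex_third t q)
      + s * (theta_third s q * hex_third t q))) (S 0 \<union> S 1 \<union> S 2)"
    using has_sum_theta_triple_mod_12(2)[OF assms]
    unfolding f_def S_def by (rule has_sum_Un_disjoint) auto
  moreover have "S 0 \<union> S 1 \<union> S 2 = UNIV"
  proof -
    have "m mod 3 = 0 \<or> m mod 3 = 1 \<or> m mod 3 = 2" for m :: int by presburger
    then show ?thesis by (auto simp: S_def)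
  qed
  ultimately have "(f has_sum (theta s (q ^ 3) * hex t (q\<^sup>2) + 2 * s * theta_third s q * hex_third t q)) UNIV"
    by (simp add: algebra_simps)
  moreover have "(f has_sum (theta s q * (theta (s * t) q)\<^sup>2)) UNIV"
    using has_sum_theta_triple[of s "s * t"] assms by (auto simp: f_def)
  ultimately show ?thesis using has_sum_unique[of f] by blast
qed

text \<open>The four differences are 2 \<open>theta_third\<close> \<open>hex_third\<close>, up to
  sign, for the four choices of (s, t). They form a matrix of rank one, so equating the two diagonal
  products eliminates all four unknown series.\<close>

lemma theta_cross:
  "((theta 1 q) ^ 3 - hex 1 (q\<^sup>2) * theta 1 (q ^ 3)) * (theta (-1) q * (theta 1 q)\<^sup>2 - hex (-1) (q\<^sup>2) * theta (-1) (q ^ 3)) =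
   (theta 1 q * (theta (-1) q)\<^sup>2 - hex (-1) (q\<^sup>2) * theta 1 (q ^ 3)) * ((theta (-1) q) ^ 3 - hex 1 (q\<^sup>2) * theta (-1) (q ^ 3))"
proof -
  have cube: "x ^ 3 = x * x\<^sup>2" for x :: real by (simp add: power3_eq_cube power2_eq_square)
  note e = theta_triple_eq[of 1 1] theta_triple_eq[of "-1" "-1"] theta_triple_eq[of 1 "-1"] theta_triple_eq[of "-1" 1]
  have "(theta 1 q) ^ 3 - hex 1 (q\<^sup>2) * theta 1 (q ^ 3) = 2 * theta_third 1 q * hex_third 1 q"
    "theta (-1) q * (theta 1 q)\<^sup>2 - hex (-1) (q\<^sup>2) * theta (-1) (q ^ 3) = - 2 * theta_third (-1) q * hex_third (-1) q"
    "theta 1 q * (theta (-1) q)\<^sup>2 - hex (-1) (q\<^sup>2) * theta 1 (q ^ 3) = 2 * theta_third 1 q * hex_third (-1) q"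
    "(theta (-1) q) ^ 3 - hex 1 (q\<^sup>2) * theta (-1) (q ^ 3) = - 2 * theta_third (-1) q * hex_third 1 q"
    unfolding cube[of "theta _ _"] using e by simp_all
  then show ?thesis by (simp only: mult_ac)
qed

end

section \<open>The cubic identity\<close>

text \<open>
  Here \<open>t3\<close>, \<open>t4\<close>, \<open>T3\<close>, \<open>T4\<close> are \<open>\<theta>(q)\<close>, \<open>\<theta>(-q)\<close>, \<open>\<theta>(q^3)\<close>, \<open>\<theta>(-q^3)\<close>, and \<open>a\<close> is \<open>a(q^2)\<close>. The unknowns
  \<open>\<sigma>\<close>, \<open>\<tau>\<close> with \<open>\<omega>\<^sup>2 = \<sigma> \<tau>\<close> are determined up to a common factor by \<open>quartic\<close>, and \<open>cross\<close> fixes that factor.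
  The hypothesis \<open>le\<close> excludes the second root of the quadratic equation for \<open>B * \<sigma> - A * \<tau>\<close>.
\<close>

lemma cubic_theta_algebra:
  fixes t3 t4 T3 T4 A B C a b :: real
  assumes pos: "t3 > 0" "t4 > 0" "T3 > 0" "T4 > 0" "a > 0" "b > 0" "C > 0"
    and A: "A = t3 * T3" and B: "B = t4 * T4" and C: "C = A - B"
    and a2: "a\<^sup>2 = A\<^sup>2 - A * B + B\<^sup>2" and b2: "b\<^sup>2 = A * B"
    and quartic: "(t3 ^ 4 - t4 ^ 4) * (T3 ^ 4 - T4 ^ 4) = C ^ 4"
    and cross: "(t3 ^ 3 - a * T3) * (t4 * t3\<^sup>2 - b * T4) = (t3 * t4\<^sup>2 - b * T3) * (t4 ^ 3 - a * T4)"
    and le: "t4\<^sup>2 * T3\<^sup>2 \<le> t3\<^sup>2 * T4\<^sup>2"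
  shows "t3 ^ 3 = T3 * (A - 2 * B + 2 * a)"
proof -
  \<comment> \<open>The goal becomes \<sigma> = A - 2 B + 2 a. In these unknowns t3^4 = A \<sigma>
    and T3^4 = A^3 / \<sigma>, and likewise for t4 and T4.\<close>
  define \<sigma> \<tau> \<omega> where "\<sigma> = t3 ^ 3 / T3" and "\<tau> = t4 ^ 3 / T4" and "\<omega> = t3\<^sup>2 * t4\<^sup>2 / b"
  have AB: "A > 0" "B > 0" and \<sigma>\<tau>\<omega>: "\<sigma> > 0" "\<tau> > 0" "\<omega> > 0"
    using pos A B by (auto simp: \<sigma>_def \<tau>_def \<omega>_def)
  have \<sigma>: "t3 ^ 3 = T3 * \<sigma>" and \<tau>: "t4 ^ 3 = T4 * \<tau>" and \<omega>: "t3\<^sup>2 * t4\<^sup>2 = b * \<omega>"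
    using pos by (auto simp: \<sigma>_def \<tau>_def \<omega>_def)
  have s: "t3 ^ 4 = A * \<sigma>" "t4 ^ 4 = B * \<tau>"
    using pos by (simp_all add: A B \<sigma>_def \<tau>_def eval_nat_numeral)
  have S: "T3 ^ 4 * \<sigma> = A ^ 3" "T4 ^ 4 * \<tau> = B ^ 3"
    using pos by (simp_all add: A B \<sigma>_def \<tau>_def eval_nat_numeral)
  have "\<omega>\<^sup>2 * (A * B) = (t3\<^sup>2 * t4\<^sup>2)\<^sup>2"
    using \<omega> b2 by (simp add: power_mult_distrib)
  also have "\<dots> = t3 ^ 4 * t4 ^ 4" by (simp add: power_mult_distrib)
  also have "\<dots> = \<sigma> * \<tau> * (A * B)" by (simp add: s)
  finally have \<omega>2: "\<omega>\<^sup>2 = \<sigma> * \<tau>" using AB by simp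
  have "(A * \<sigma> - B * \<tau>) * (A ^ 3 * \<tau> - B ^ 3 * \<sigma>) = (t3 ^ 4 - t4 ^ 4) * (T3 ^ 4 - T4 ^ 4) * (\<sigma> * \<tau>)"
    by (simp add: s algebra_simps flip: S)
  then have quartic': "(A * \<sigma> - B * \<tau>) * (A ^ 3 * \<tau> - B ^ 3 * \<sigma>) = C ^ 4 * (\<sigma> * \<tau>)"
    by (simp only: quartic)
  \<comment> \<open>The quartic relation is homogeneous in \<sigma>, \<tau>. Since \<omega>^2 =
    \<sigma> \<tau> and (A^2 - B^2)^2 - C^4 = 4 A B C^2, it becomes an equality of two
    squares.\<close>
  have "(B * \<sigma> - A * \<tau>)\<^sup>2 * (A * B) =
      (A\<^sup>2 - B\<^sup>2)\<^sup>2 * (\<sigma> * \<tau>) - (A * \<sigma> - B * \<tau>) * (A ^ 3 * \<tau> - B ^ 3 * \<sigma>)" by algebra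
  also have "\<dots> = (2 * C)\<^sup>2 * (\<sigma> * \<tau>) * (A * B)" unfolding quartic' unfolding C by algebra
  also have "\<dots> = (2 * C * \<omega>)\<^sup>2 * (A * B)" by (simp add: \<omega>2 power_mult_distrib)
  finally have lin2: "(B * \<sigma> - A * \<tau>)\<^sup>2 = (2 * C * \<omega>)\<^sup>2" using AB by simp
  have le': "A * \<tau> \<le> B * \<sigma>"
  proof -
    have "A * \<tau> * (T3 * T4) = t3 * T3\<^sup>2 * (T4 * \<tau>)" by (simp add: A power2_eq_square)
    also have "\<dots> = t3 * t4 * (t4\<^sup>2 * T3\<^sup>2)"
      by (simp add: power2_eq_square power3_eq_cube flip: \<tau>)
    also have "\<dots> \<le> t3 * t4 * (t3\<^sup>2 * T4\<^sup>2)" using pos le by (intro mult_left_mono) auto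
    also have "\<dots> = t4 * T4\<^sup>2 * (T3 * \<sigma>)"
      by (simp add: power2_eq_square power3_eq_cube flip: \<sigma>)
    also have "\<dots> = B * \<sigma> * (T3 * T4)" by (simp add: B power2_eq_square)
    finally show ?thesis using pos by simp
  qed
  have lin: "B * \<sigma> - A * \<tau> = 2 * C * \<omega>"
    using lin2 by (rule power2_eq_imp_eq) (use le' \<sigma>\<tau>\<omega> pos in simp_all)
  \<comment> \<open>Multiplied by B \<tau>, the linear relation is a quadratic for B \<omega> /
    \<tau> with roots C + a and C - a. Only D is positive, so \<sigma> : \<omega> : \<tau> = D^2 : B
    D : B^2.\<close>
  define D where "D = C + a"
  have "(B * \<omega> - C * \<tau>)\<^sup>2 = (a * \<tau>)\<^sup>2"
  proof -
    have "(B * \<omega> - C * \<tau>)\<^sup>2 = B * (B * \<omega>\<^sup>2 - 2 * C * \<omega> * \<tau>) + C\<^sup>2 * \<tau>\<^sup>2" by algebra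
    also have "\<dots> = (A * B + C\<^sup>2) * \<tau>\<^sup>2" unfolding lin[symmetric] \<omega>2 by algebra
    also have "A * B + C\<^sup>2 = a\<^sup>2" unfolding a2 C by algebra
    finally show ?thesis by (simp add: power_mult_distrib)
  qed
  then have "B * \<omega> - C * \<tau> = a * \<tau> \<or> B * \<omega> - C * \<tau> = - (a * \<tau>)"
    by (simp add: power2_eq_iff)
  moreover have "C < a"
  proof (rule power2_less_imp_less)
    have "a\<^sup>2 = C\<^sup>2 + A * B" unfolding a2 C by algebra
    then show "C\<^sup>2 < a\<^sup>2" using AB by simp
  qed (use pos in auto)
  then have "C * \<tau> < a * \<tau>" "0 < B * \<omega>" using \<sigma>\<tau>\<omega> AB by auto
  ultimately have D: "B * \<omega> = D * \<tau>" by (auto simp: D_def algebra_simps)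
  have "B\<^sup>2 * \<sigma> * \<tau> = (B * \<omega>)\<^sup>2" by (simp add: \<omega>2 power_mult_distrib)
  also have "\<dots> = D\<^sup>2 * \<tau> * \<tau>" unfolding D by algebra
  finally have B\<sigma>: "B\<^sup>2 * \<sigma> = D\<^sup>2 * \<tau>" using \<sigma>\<tau>\<omega> by simp
  \<comment> \<open>In \<open>cross\<close> the terms a b T3 T4 cancel. Multiplying by t3 t4
    expresses the rest through A, B, \<sigma>, \<tau>, \<omega>; the result \<open>star\<close> has
    parts of different degree in \<sigma>, \<tau>, \<omega>, which determines the common
    factor.\<close>
  have "t3\<^sup>2 * t4\<^sup>2 * (t3 ^ 4 - t4 ^ 4 - a * C) - b * (B * t3 ^ 4 - A * t4 ^ 4) =
      t3 * t4 * ((t3 ^ 3 - a * T3) * (t4 * t3\<^sup>2 - b * T4) - (t3 * t4\<^sup>2 - b * T3) * (t4 ^ 3 - a * T4))"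
    unfolding A B C by algebra
  also have "\<dots> = 0" using cross by simp
  finally have "b * (\<omega> * (A * \<sigma> - B * \<tau> - a * C)) = b * (A * B * (\<sigma> - \<tau>))"
    unfolding \<omega> s by (simp add: algebra_simps)
  then have star: "\<omega> * (A * \<sigma> - B * \<tau> - a * C) = A * B * (\<sigma> - \<tau>)" using pos by simp
  have "D * \<tau> * (A * (D\<^sup>2 * \<tau>) - B ^ 3 * \<tau> - a * C * B\<^sup>2) = B ^ 3 * (\<omega> * (A * \<sigma> - B * \<tau> - a * C))"
    unfolding D[symmetric] B\<sigma>[symmetric] by algebra
  also have "\<dots> = A * B\<^sup>2 * (B\<^sup>2 * \<sigma> - B\<^sup>2 * \<tau>)" unfolding star by algebra
  also have "\<dots> = A * B\<^sup>2 * (D\<^sup>2 - B\<^sup>2) * \<tau>" unfolding B\<sigma> by algebra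
  finally have "D * \<tau> * (A * D\<^sup>2 * \<tau> - B ^ 3 * \<tau> - a * C * B\<^sup>2) = A * B\<^sup>2 * (D\<^sup>2 - B\<^sup>2) * \<tau>"
    by (simp only: mult.assoc)
  then have "\<tau> * (D * (A * D\<^sup>2 * \<tau> - B ^ 3 * \<tau> - a * C * B\<^sup>2)) = \<tau> * (A * B\<^sup>2 * (D\<^sup>2 - B\<^sup>2))"
    by (simp add: mult_ac)
  then have K: "D * (A * D\<^sup>2 * \<tau> - B ^ 3 * \<tau> - a * C * B\<^sup>2) = A * B\<^sup>2 * (D\<^sup>2 - B\<^sup>2)"
    using \<sigma>\<tau>\<omega> by simp
  \<comment> \<open>This holds modulo the quadratic relation for a; together with K it shows that
    the value of \<sigma> forced by \<open>star\<close> is A - 2 B + 2 a.\<close>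
  have J: "D * (A * (D\<^sup>2 - B\<^sup>2) + a * C * D) = (A - 2 * B + 2 * a) * (A * D\<^sup>2 - B ^ 3)"
    unfolding D_def C using a2 by algebra
  have "(A * D\<^sup>2 - B ^ 3) * (B\<^sup>2 * \<sigma>) =
      D * (D * (A * D\<^sup>2 * \<tau> - B ^ 3 * \<tau> - a * C * B\<^sup>2)) + a * C * B\<^sup>2 * D\<^sup>2"
    unfolding B\<sigma> by algebra
  also have "\<dots> = B\<^sup>2 * (D * (A * (D\<^sup>2 - B\<^sup>2) + a * C * D))" unfolding K by algebra
  also have "\<dots> = (A * D\<^sup>2 - B ^ 3) * (B\<^sup>2 * (A - 2 * B + 2 * a))" unfolding J by algebra
  finally have "(A * D\<^sup>2 - B ^ 3) * (B\<^sup>2 * \<sigma>) = (A * D\<^sup>2 - B ^ 3) * (B\<^sup>2 * (A - 2 * B + 2 * a))" .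
  \<comment> \<open>The common factor A D^2 - B^3 is positive because B < A and B < a < D.\<close>
  moreover have "B\<^sup>2 < a\<^sup>2"
  proof -
    have "a\<^sup>2 = B\<^sup>2 + A * C" unfolding a2 C by algebra
    then show ?thesis using AB pos by simp
  qed
  then have "B < D" using power2_less_imp_less[of B a] pos by (simp add: D_def)
  then have "B\<^sup>2 < D\<^sup>2" using AB by (intro power_strict_mono) auto
  then have "B * B\<^sup>2 < A * D\<^sup>2" using AB C pos by (intro mult_strict_mono) auto
  then have "A * D\<^sup>2 - B ^ 3 \<noteq> 0" by (simp add: power3_eq_cube power2_eq_square)
  ultimately have "\<sigma> = A - 2 * B + 2 * a" using AB by simp
  then show ?thesis using \<sigma> by simp
qed

section \<open>Positivity and size of the theta values\<close>

context
  fixes q :: real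
  assumes q: "0 < q" "q < 1"
begin

lemma theta_ge_1: "1 \<le> theta 1 q"
proof -
  have "sum (\<lambda>n::int. 1 powi n * q powi n\<^sup>2) {0} \<le> theta 1 q"
    using q by (intro finite_sum_le_has_sum[OF has_sum_theta]) auto
  then show ?thesis by simp
qed

lemma psi_ge_2: "2 \<le> psi q"
proof -
  have "sum (\<lambda>n::int. q powi (n\<^sup>2 + n)) {0, -1} \<le> psi q"
    using q by (intro finite_sum_le_has_sum[OF has_sum_psi]) auto
  then show ?thesis by simp
qed

text \<open>Odd n cancel and even n double, so n = 0 alone contributes 2. Together with
  \<open>theta 1 q < 2\<close> this makes \<open>theta (-1) q\<close> positive.\<close>

lemma theta_add_ge_2: "2 \<le> theta 1 q + theta (-1) q"
proof -
  have "((\<lambda>n::int. 1 powi n * q powi n\<^sup>2 + (-1) powi n * q powi n\<^sup>2) has_sum (theta 1 q + theta (-1) q)) UNIV"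
    using q by (intro has_sum_add has_sum_theta) auto
  then have "sum (\<lambda>n::int. 1 powi n * q powi n\<^sup>2 + (-1) powi n * q powi n\<^sup>2) {0} \<le> theta 1 q + theta (-1) q"
    by (rule finite_sum_le_has_sum) (use q in \<open>auto simp: power_int_minus_left\<close>)
  then show ?thesis by simp
qed

lemma theta_less_2:
  assumes "3 * q < 1"
  shows "theta 1 q < 2"
proof -
  have "theta 1 q \<le> 1 + 2 * (q / (1 - q))"
    by (rule has_sum_mono[OF has_sum_theta has_sum_power_int_abs]) (use q in \<open>auto intro!: power_int_decreasing abs_le_square\<close>)
  also have "\<dots> < 2" using assms by (simp add: field_simps)
  finally show ?thesis .
qed

lemma psi_mono:
  assumes "0 < p" "p \<le> q"
  shows "psi p \<le> psi q"
proof (rule has_sum_mono[OF has_sum_psi has_sum_psi])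
  fix n :: int
  have "0 \<le> n\<^sup>2 + n" using abs_le_square[of n] by linarith
  then show "p powi (n\<^sup>2 + n) \<le> q powi (n\<^sup>2 + n)" using assms by (intro power_int_mono) auto
qed (use assms q in auto)

text \<open>Jacobi's identity \<theta>_3^4 = \<theta>_4^4 + \<theta>_2^4, obtained by factoring the
  left side as a difference of squares.\<close>

lemma theta_quartic: "(theta 1 q) ^ 4 - (theta (-1) q) ^ 4 = q * (psi q) ^ 4"
proof -
  have "(theta 1 q) ^ 4 - (theta (-1) q) ^ 4 =
      ((theta 1 q)\<^sup>2 - (theta (-1) q)\<^sup>2) * ((theta 1 q)\<^sup>2 + (theta (-1) q)\<^sup>2)" by algebra
  also have "\<dots> = q * (2 * theta 1 (q\<^sup>2) * psi (q\<^sup>2))\<^sup>2"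
    unfolding theta_squares_add[OF q] theta_squares_diff[OF q] by algebra
  also have "\<dots> = q * ((psi q)\<^sup>2)\<^sup>2" using psi_square[OF q] by simp
  finally show ?thesis by simp
qed

end

lemma theta_cubed:
  fixes q :: real
  assumes q0: "0 < q" and q3: "3 * q < 1"
  shows "(theta 1 q) ^ 3 = theta 1 (q ^ 3) * (2 * hex 1 (q\<^sup>2) + hex 1 q - 2 * hex 1 (q ^ 4))"
proof -
  have q: "0 < q" "q < 1" using assms by auto
  have q2: "0 < q\<^sup>2" "q\<^sup>2 < 1" and q3': "0 < q ^ 3" "q ^ 3 < 1" and q6: "0 < (q ^ 3)\<^sup>2" "(q ^ 3)\<^sup>2 < 1"
    using power_less_one[OF q, of 2] power_less_one[OF q, of 3] power_less_one[OF q, of 6]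
    by (auto simp flip: power_mult)
  have "q ^ 3 \<le> q" using q power_decreasing[of 1 3 q] by simp
  then have q33: "3 * q ^ 3 < 1" using q3 by simp
  define t3 t4 T3 T4 where "t3 = theta 1 q" and "t4 = theta (-1) q" and "T3 = theta 1 (q ^ 3)" and "T4 = theta (-1) (q ^ 3)"
  define A B C where "A = t3 * T3" and "B = t4 * T4" and "C = q * (psi q * psi (q ^ 3))"
  define a b where "a = hex 1 (q\<^sup>2)" and "b = hex (-1) (q\<^sup>2)"
  define x y X Y where "x = theta 1 (q\<^sup>2)" and "y = psi (q\<^sup>2)" and "X = theta 1 ((q ^ 3)\<^sup>2)" and "Y = psi ((q ^ 3)\<^sup>2)"
  have t3: "1 \<le> t3" "t3 < 2" and t4: "t4 > 0" and T3: "1 \<le> T3" "T3 < 2" and T4: "T4 > 0"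
    using theta_ge_1[OF q] theta_ge_1[OF q3'] theta_less_2[OF q q3] theta_less_2[OF q3' q33]
      theta_add_ge_2[OF q] theta_add_ge_2[OF q3'] unfolding t3_def t4_def T3_def T4_def by linarith+
  have psi: "2 \<le> psi q" "2 \<le> psi (q ^ 3)" "2 \<le> y" "2 \<le> Y" "1 \<le> x" "1 \<le> X"
    unfolding y_def Y_def x_def X_def
    by (intro psi_ge_2 theta_ge_1 q q2 q3' q6)+
  have "C > 0" unfolding C_def using q psi by (intro mult_pos_pos) auto
  have ABC: "A = B + C"
    using theta_cubic_modular_equation[OF q] by (simp add: A_def B_def C_def t3_def t4_def T3_def T4_def)
  have e: "t3\<^sup>2 + t4\<^sup>2 = 2 * x\<^sup>2" "t3\<^sup>2 - t4\<^sup>2 = 2 * q * y\<^sup>2" "T3\<^sup>2 + T4\<^sup>2 = 2 * X\<^sup>2" "T3\<^sup>2 - T4\<^sup>2 = 2 * q ^ 3 * Y\<^sup>2"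
    "(psi q)\<^sup>2 = 2 * x * y" "(psi (q ^ 3))\<^sup>2 = 2 * X * Y"
    using theta_squares_add theta_squares_diff psi_square q q3'
    unfolding t3_def t4_def T3_def T4_def x_def y_def X_def Y_def by blast+
  \<comment> \<open>U and V are the two parts of \<open>hex 1\<close> and \<open>hex (-1)\<close> at
    q^2. Their squares are polynomials in t3, t4, T3, T4, and 4 U V = C^2, so a^2 and b^2 can be
    expressed in A and B.\<close>
  define U V where "U = x * X" and "V = q\<^sup>2 * (y * Y)"
  have UV: "a = U + V" "b = U - V"
  proof -
    have "(q\<^sup>2) ^ 3 = (q ^ 3)\<^sup>2" by (simp flip: power_mult)
    then show "a = U + V" "b = U - V"
      unfolding a_def b_def U_def V_def x_def X_def y_def Y_def using hex_eq[OF q2] by simp_all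
  qed
  have UVpos: "0 < U" "0 < V" using psi q by (auto simp: U_def V_def)
  have U2: "4 * U\<^sup>2 = (t3\<^sup>2 + t4\<^sup>2) * (T3\<^sup>2 + T4\<^sup>2)" unfolding e U_def by algebra
  have V2: "4 * V\<^sup>2 = (t3\<^sup>2 - t4\<^sup>2) * (T3\<^sup>2 - T4\<^sup>2)" unfolding e V_def by algebra
  have C2: "C\<^sup>2 = 4 * U * V"
  proof -
    have "C\<^sup>2 = q\<^sup>2 * ((psi q)\<^sup>2 * (psi (q ^ 3))\<^sup>2)" by (simp add: C_def power_mult_distrib)
    also have "\<dots> = 4 * U * V" unfolding e(5,6) U_def V_def by algebra
    finally show ?thesis .
  qed
  have AB2: "A\<^sup>2 + B\<^sup>2 = 2 * (U\<^sup>2 + V\<^sup>2)"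
  proof -
    have "2 * (A\<^sup>2 + B\<^sup>2) = 4 * U\<^sup>2 + 4 * V\<^sup>2" unfolding U2 V2 A_def B_def by algebra
    then show ?thesis by simp
  qed
  have CAB: "C\<^sup>2 = A\<^sup>2 + B\<^sup>2 - 2 * A * B" unfolding ABC by algebra
  have b2: "b\<^sup>2 = A * B"
  proof -
    have "2 * b\<^sup>2 = 2 * (U\<^sup>2 + V\<^sup>2) - 4 * U * V" unfolding UV by algebra
    also have "\<dots> = 2 * (A * B)" unfolding AB2[symmetric] C2[symmetric] CAB by algebra
    finally show ?thesis by simp
  qed
  have a2: "a\<^sup>2 = A\<^sup>2 - A * B + B\<^sup>2"
  proof -
    have "2 * a\<^sup>2 = 2 * (U\<^sup>2 + V\<^sup>2) + 4 * U * V" unfolding UV by algebra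
    also have "\<dots> = 2 * (A\<^sup>2 - A * B + B\<^sup>2)" unfolding AB2[symmetric] C2[symmetric] CAB by algebra
    finally show ?thesis by simp
  qed
  \<comment> \<open>This says that b is positive, as \<open>cubic_theta_algebra\<close>
    requires.\<close>
  have "V < U"
  proof (rule power2_less_imp_less)
    have "4 * U\<^sup>2 - 4 * V\<^sup>2 = 2 * (t3\<^sup>2 * T4\<^sup>2 + t4\<^sup>2 * T3\<^sup>2)" unfolding U2 V2 by algebra
    also have "\<dots> > 0" using t3 t4 T3 T4 by (intro mult_pos_pos add_pos_pos) auto
    finally show "V\<^sup>2 < U\<^sup>2" by simp
  qed (use UVpos in auto)
  have "t3 ^ 3 = T3 * (A - 2 * B + 2 * a)"
  proof (rule cubic_theta_algebra)
    show "(t3 ^ 4 - t4 ^ 4) * (T3 ^ 4 - T4 ^ 4) = C ^ 4"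
      unfolding t3_def t4_def T3_def T4_def C_def theta_quartic[OF q] theta_quartic[OF q3'] by algebra
    show "(t3 ^ 3 - a * T3) * (t4 * t3\<^sup>2 - b * T4) = (t3 * t4\<^sup>2 - b * T3) * (t4 ^ 3 - a * T4)"
      unfolding t3_def t4_def T3_def T4_def a_def b_def using theta_cross[OF q] .
    \<comment> \<open>The difference of the two sides is 2 q (T3^2 y^2 - q^2 t3^2 Y^2), which is
      nonnegative because Y \<le> y and q t3 < 2/3 < 1 \<le> T3.\<close>
    show "t4\<^sup>2 * T3\<^sup>2 \<le> t3\<^sup>2 * T4\<^sup>2"
    proof -
      have "q ^ 6 \<le> q ^ 2" using q by (intro power_decreasing) auto
      then have "Y \<le> y" unfolding y_def Y_def using q2 q by (intro psi_mono) (auto simp flip: power_mult)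
      then have "Y\<^sup>2 \<le> y\<^sup>2" using psi by (intro power_mono) auto
      have "1\<^sup>2 \<le> T3\<^sup>2" using T3 by (intro power_mono) simp_all
      have "q\<^sup>2 * t3\<^sup>2 \<le> (1 / 3)\<^sup>2 * 2\<^sup>2"
        using t3 q q3 by (intro mult_mono power_mono) auto
      also have "\<dots> \<le> T3\<^sup>2" using \<open>1\<^sup>2 \<le> T3\<^sup>2\<close> by (simp add: power2_eq_square)
      finally have "(q\<^sup>2 * t3\<^sup>2) * Y\<^sup>2 \<le> T3\<^sup>2 * y\<^sup>2"
        using \<open>Y\<^sup>2 \<le> y\<^sup>2\<close> by (intro mult_mono) auto
      then have "2 * q * ((q\<^sup>2 * t3\<^sup>2) * Y\<^sup>2) \<le> 2 * q * (T3\<^sup>2 * y\<^sup>2)" using q by (intro mult_left_mono) auto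
      moreover have "2 * q * ((q\<^sup>2 * t3\<^sup>2) * Y\<^sup>2) = t3\<^sup>2 * (T3\<^sup>2 - T4\<^sup>2)" unfolding e by algebra
      moreover have "2 * q * (T3\<^sup>2 * y\<^sup>2) = (t3\<^sup>2 - t4\<^sup>2) * T3\<^sup>2" unfolding e by algebra
      ultimately show ?thesis by (simp add: algebra_simps)
    qed
  qed (use t3 t4 T3 T4 \<open>C > 0\<close> \<open>V < U\<close> UVpos ABC a2 b2 in \<open>simp_all add: UV A_def B_def\<close>)
  \<comment> \<open>With C = A - B these give a(q) - 2 a(q^4) = A - 2 B.\<close>
  moreover have "hex 1 q = A + C" "2 * hex 1 (q ^ 4) = A + B"
    using hex_eq(1)[OF q] hex_power4[OF q] by (simp_all add: A_def B_def C_def t3_def t4_def T3_def T4_def)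
  ultimately show ?thesis
    using ABC by (simp add: a_def t3_def T3_def)
qed

section \<open>Counting representations\<close>

text \<open>Grouping the terms by exponent turns a theta sum into the power series of its
  representation numbers. A fibre is finite because the positive constant q^n is not summable over
  an infinite set.\<close>

lemma has_sum_fibres:
  fixes k :: "'a \<Rightarrow> int" and q :: real
  assumes "((\<lambda>x. q powi k x) has_sum a) S" "\<And>x. x \<in> S \<Longrightarrow> 0 \<le> k x" "0 < q"
  shows "finite {x \<in> S. k x = int n}"
    and "(\<lambda>n. real (card {x \<in> S. k x = int n}) * q ^ n) sums a"
proof -
  show fin: "finite {x \<in> S. k x = int n}" for n
  proof (rule ccontr)
    assume inf: "infinite {x \<in> S. k x = int n}"
    have "(\<lambda>x. q powi k x) summable_on {x \<in> S. k x = int n}"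
      using has_sum_imp_summable[OF assms(1)] by (rule summable_on_subset_banach) auto
    then have "(\<lambda>x. q powi int n) summable_on {x \<in> S. k x = int n}"
      by (rule summable_on_cong[THEN iffD1, rotated]) auto
    with infsum_diverge_constant[OF inf, of "q powi int n"] assms(3) show False by simp
  qed
  have "((\<lambda>(n, x). q powi k x) has_sum a) (SIGMA n:UNIV. {x \<in> S. k x = int n})"
    using assms(1)
    by (subst has_sum_reindex_bij_witness[of _ "\<lambda>x. (nat (k x), x)" snd S "\<lambda>x. q powi k x" _ _ a])
       (use assms(2) in auto)
  moreover have "((\<lambda>x. case (n, x) of (n, x) \<Rightarrow> q powi k x) has_sum (real (card {x \<in> S. k x = int n}) * q ^ n))
      {x \<in> S. k x = int n}" for n
    using has_sum_constant[OF fin[of n], of "q ^ n"] by (rule has_sum_cong[THEN iffD1, rotated]) simp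
  ultimately have "((\<lambda>n. real (card {x \<in> S. k x = int n}) * q ^ n) has_sum a) UNIV"
    by (rule has_sum_Sigma')
  then show "(\<lambda>n. real (card {x \<in> S. k x = int n}) * q ^ n) sums a"
    by (rule has_sum_imp_sums)
qed

text \<open>A nonzero coefficient would make the zeros of the power series isolated, whereas it
  vanishes at points arbitrarily close to 0.\<close>

lemma powser_zero_coeffs:
  fixes d :: "nat \<Rightarrow> real"
  assumes "r > 0" and sums: "\<And>q. 0 < q \<Longrightarrow> q < r \<Longrightarrow> (\<lambda>n. d n * q ^ n) sums 0"
  shows "d m = 0"
proof (rule ccontr)
  assume "d m \<noteq> 0"
  \<comment> \<open>\<open>powser_0_nonzero\<close> concerns a series vanishing at its centre; the
    factor x forces this and shifts the coefficients by one.\<close>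
  define a where "a n = (case n of 0 \<Rightarrow> 0 | Suc n \<Rightarrow> d n)" for n
  define f where "f x = x * suminf (\<lambda>n. d n * x ^ n)" for x
  have "summable (\<lambda>n. d n * (r / 2) ^ n)" using sums[of "r / 2"] \<open>r > 0\<close> by (simp add: sums_iff)
  then have sm: "summable (\<lambda>n. d n * x ^ n)" if "norm x < r / 2" for x
    using powser_inside[of d "r / 2" x] that \<open>r > 0\<close> by simp
  have "(\<lambda>n. a n * (x - 0) ^ n) sums f x" if "norm (x - 0) < r / 2" for x
  proof -
    have "(\<lambda>n. x * (d n * x ^ n)) sums f x"
      unfolding f_def using sm[of x] that by (intro sums_mult summable_sums) simp
    then show ?thesis using sums_Suc[of "\<lambda>n. a n * x ^ n" "f x"] by (simp add: a_def mult_ac)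
  qed
  moreover have "f 0 = 0" "a (Suc m) \<noteq> 0" using \<open>d m \<noteq> 0\<close> by (simp_all add: f_def a_def)
  ultimately obtain s where s: "0 < s" "\<And>z. z \<in> cball 0 s - {0} \<Longrightarrow> f z \<noteq> 0"
    using powser_0_nonzero[of "r / 2" 0 a f "Suc m"] \<open>r > 0\<close> by auto
  define z where "z = min s (r / 2)"
  have z: "0 < z" "z < r" "z \<in> cball 0 s - {0}" using s \<open>r > 0\<close> by (auto simp: z_def)
  then have "f z = 0" using sums[of z] by (simp add: f_def sums_iff)
  with s(2) z(3) show False by blast
qed

section \<open>Counting representations of 9 n by residues modulo 3\<close>

lemma square_mod_3: "x\<^sup>2 mod 3 = (if 3 dvd x then 0 else 1)" for x :: int
proof -
  have "x mod 3 = 0 \<or> x mod 3 = 1 \<or> x mod 3 = 2" by presburger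
  then have "(x mod 3)\<^sup>2 mod 3 = (if 3 dvd x then 0 else 1)"
    by (elim disjE) (simp_all add: dvd_eq_mod_eq_0)
  then show ?thesis by (simp only: power_mod)
qed

text \<open>Squares are 0 or 1 modulo 3, so the sum vanishes modulo 3 only if all three coordinates
  or none are divisible by 3.\<close>

lemma three_dvd_sum_squares:
  fixes x y z :: int
  assumes "3 dvd x\<^sup>2 + y\<^sup>2 + z\<^sup>2"
  shows "3 dvd x \<longleftrightarrow> 3 dvd y" "3 dvd x \<longleftrightarrow> 3 dvd z"
proof -
  have "3 dvd a + b + c \<Longrightarrow> (a mod 3 + b mod 3 + c mod 3) mod 3 = 0" for a b c :: int by presburger
  from this[OF assms] have "(x\<^sup>2 mod 3 + y\<^sup>2 mod 3 + z\<^sup>2 mod 3) mod 3 = 0" .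
  then show "3 dvd x \<longleftrightarrow> 3 dvd y" "3 dvd x \<longleftrightarrow> 3 dvd z"
    unfolding square_mod_3 by (auto split: if_splits)
qed

definition squares_reps :: "int \<Rightarrow> (int \<times> int \<times> int) set" where
  "squares_reps n = {(x, y, z). x\<^sup>2 + y\<^sup>2 + z\<^sup>2 = n}"

text \<open>Representatives for sign changes of y and z, with x kept fixed: all three coordinates
  share one nonzero residue modulo 3.\<close>

definition aligned_reps :: "int \<Rightarrow> (int \<times> int \<times> int) set" where
  "aligned_reps n = {(x, y, z). x\<^sup>2 + y\<^sup>2 + z\<^sup>2 = n \<and> \<not> 3 dvd x \<and> 3 dvd y - x \<and> 3 dvd z - x}"

lemma bij_betw_triple:
  "bij_betw (\<lambda>(u, v, w). (3 * u, 3 * v, 3 * w)) (squares_reps n)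
    {(x, y, z). (x, y, z) \<in> squares_reps (9 * n) \<and> 3 dvd x}"
proof -
  have e: "(3 * u)\<^sup>2 + (3 * v)\<^sup>2 + (3 * w)\<^sup>2 = 9 * (u\<^sup>2 + v\<^sup>2 + w\<^sup>2)" for u v w :: int
    by (simp add: power_mult_distrib)
  show ?thesis
  proof (rule bij_betw_imageI)
    show "inj_on (\<lambda>(u, v, w). (3 * u, 3 * v, 3 * w)) (squares_reps n)" by (auto simp: inj_on_def)
    show "(\<lambda>(u, v, w). (3 * u, 3 * v, 3 * w)) ` squares_reps n =
        {(x, y, z). (x, y, z) \<in> squares_reps (9 * n) \<and> 3 dvd x}"
    proof (intro equalityI subsetI)
      fix p assume "p \<in> (\<lambda>(u, v, w). (3 * u, 3 * v, 3 * w)) ` squares_reps n"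
      then show "p \<in> {(x, y, z). (x, y, z) \<in> squares_reps (9 * n) \<and> 3 dvd x}"
        using e by (auto simp: squares_reps_def)
    next
      fix p assume "p \<in> {(x, y, z). (x, y, z) \<in> squares_reps (9 * n) \<and> 3 dvd x}"
      then obtain x y z where p: "p = (x, y, z)" "x\<^sup>2 + y\<^sup>2 + z\<^sup>2 = 9 * n" "3 dvd x"
        by (auto simp: squares_reps_def)
      from p(2) have "3 dvd x\<^sup>2 + y\<^sup>2 + z\<^sup>2" by simp
      with p(3) have "3 dvd y" "3 dvd z" using three_dvd_sum_squares by blast+
      with p(3) obtain u v w where uvw: "x = 3 * u" "y = 3 * v" "z = 3 * w" by (auto elim!: dvdE)
      with p(2) have "(u, v, w) \<in> squares_reps n" using e[of u v w] by (simp add: squares_reps_def)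
      then show "p \<in> (\<lambda>(u, v, w). (3 * u, 3 * v, 3 * w)) ` squares_reps n"
        unfolding p(1) uvw by force
    qed
  qed
qed

text \<open>If 3 divides neither x nor y, exactly one of y and -y is congruent to x. The two free
  signs account for the factor 4.\<close>

lemma bij_betw_signs:
  "bij_betw (\<lambda>(d, e, x, y, z). (x, d * y, e * z)) ({1, -1} \<times> {1, -1} \<times> aligned_reps (9 * n))
    {(x, y, z). (x, y, z) \<in> squares_reps (9 * n) \<and> \<not> 3 dvd x}"
proof (rule bij_betw_imageI)
  have key: "d = d' \<and> y = y'"
    if "d * y = d' * y'" "d \<in> {1, -1}" "d' \<in> {1, -1}" "3 dvd y - x" "3 dvd y' - x" "\<not> 3 dvd x" for d d' x y y' :: int
  proof -
    have False if "y = - y'"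
    proof -
      have "3 dvd (y - x) + (y' - x)" using \<open>3 dvd y - x\<close> \<open>3 dvd y' - x\<close> by (rule dvd_add)
      then have "3 dvd - 2 * x" using that by simp
      then show False using \<open>\<not> 3 dvd x\<close> by presburger
    qed
    then show ?thesis using that(1-3) by auto
  qed
  show "inj_on (\<lambda>(d, e, x, y, z). (x, d * y, e * z)) ({1, -1} \<times> {1, -1} \<times> aligned_reps (9 * n))"
  proof (rule inj_onI)
    fix p p' assume pp: "p \<in> {1, -1} \<times> {1, -1} \<times> aligned_reps (9 * n)"
      "p' \<in> {1, -1} \<times> {1, -1} \<times> aligned_reps (9 * n)"
      "(case p of (d, e, x, y, z) \<Rightarrow> (x, d * y, e * z)) = (case p' of (d, e, x, y, z) \<Rightarrow> (x, d * y, e * z))"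
    obtain d e x y z d' e' x' y' z' where p: "p = (d, e, x, y, z)" "p' = (d', e', x', y', z')"
      by (cases p, cases p')
    have "d = d' \<and> y = y'" "e = e' \<and> z = z'"
      by (rule key[where x = x]; use pp p in \<open>simp add: aligned_reps_def\<close>)+
    then show "p = p'" using pp(3) p by simp
  qed
  show "(\<lambda>(d, e, x, y, z). (x, d * y, e * z)) ` ({1, -1} \<times> {1, -1} \<times> aligned_reps (9 * n)) =
      {(x, y, z). (x, y, z) \<in> squares_reps (9 * n) \<and> \<not> 3 dvd x}"
  proof (intro equalityI subsetI)
    fix p assume "p \<in> (\<lambda>(d, e, x, y, z). (x, d * y, e * z)) ` ({1, -1} \<times> {1, -1} \<times> aligned_reps (9 * n))"
    then show "p \<in> {(x, y, z). (x, y, z) \<in> squares_reps (9 * n) \<and> \<not> 3 dvd x}"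
      by (auto simp: squares_reps_def aligned_reps_def)
  next
    fix p assume "p \<in> {(x, y, z). (x, y, z) \<in> squares_reps (9 * n) \<and> \<not> 3 dvd x}"
    then obtain x y z where p: "p = (x, y, z)" "x\<^sup>2 + y\<^sup>2 + z\<^sup>2 = 9 * n" "\<not> 3 dvd x"
      by (auto simp: squares_reps_def)
    from p(2) have "3 dvd x\<^sup>2 + y\<^sup>2 + z\<^sup>2" by simp
    with p(3) have ndvd: "\<not> 3 dvd y" "\<not> 3 dvd z" using three_dvd_sum_squares by blast+
    have sgn: "\<exists>d \<in> {1, -1}. 3 dvd d * y - x" if "\<not> 3 dvd y" for y
    proof -
      have "3 dvd 1 * y - x \<or> 3 dvd - 1 * y - x" using that p(3) by presburger
      then show ?thesis by blast
    qed
    obtain d e where d: "d \<in> {1, -1}" "3 dvd d * y - x" and e: "e \<in> {1, -1}" "3 dvd e * z - x"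
      using sgn ndvd by meson
    have "(x, d * y, e * z) \<in> aligned_reps (9 * n)"
      using d e p by (auto simp: aligned_reps_def)
    moreover have "p = (x, d * (d * y), e * (e * z))" using d e p by auto
    ultimately show "p \<in> (\<lambda>(d, e, x, y, z). (x, d * y, e * z)) ` ({1, -1} \<times> {1, -1} \<times> aligned_reps (9 * n))"
      using d(1) e(1) by (intro image_eqI[of _ _ "(d, e, x, d * y, e * z)"]) auto
  qed
qed

text \<open>The map is 3 times the reflection in the plane orthogonal to \<open>(1, 1, 1)\<close>.\<close>

lemma bij_betw_reflection:
  "bij_betw (\<lambda>(u, v, w). (u - 2 * v - 2 * w, v - 2 * u - 2 * w, w - 2 * u - 2 * v))
    {(u, v, w). (u, v, w) \<in> squares_reps n \<and> (u + v + w) mod 3 \<noteq> 0} (aligned_reps (9 * n))"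
    (is "bij_betw ?r ?A _")
proof (rule bij_betw_imageI)
  show "inj_on ?r ?A" by (auto simp: inj_on_def)
  have Q: "(u - 2 * v - 2 * w)\<^sup>2 + (v - 2 * u - 2 * w)\<^sup>2 + (w - 2 * u - 2 * v)\<^sup>2 = 9 * (u\<^sup>2 + v\<^sup>2 + w\<^sup>2)" for u v w :: int
    by (simp add: power2_eq_square algebra_simps)
  show "?r ` ?A = aligned_reps (9 * n)"
  proof (intro equalityI subsetI)
    fix p assume "p \<in> ?r ` ?A"
    then obtain u v w where p: "p = (u - 2 * v - 2 * w, v - 2 * u - 2 * w, w - 2 * u - 2 * v)"
      "u\<^sup>2 + v\<^sup>2 + w\<^sup>2 = n" "(u + v + w) mod 3 \<noteq> 0" by (auto simp: squares_reps_def)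
    have "\<not> 3 dvd u - 2 * v - 2 * w" "3 dvd (v - 2 * u - 2 * w) - (u - 2 * v - 2 * w)"
      "3 dvd (w - 2 * u - 2 * v) - (u - 2 * v - 2 * w)"
      using p(3) by presburger+
    then show "p \<in> aligned_reps (9 * n)"
      unfolding aligned_reps_def p(1) mem_Collect_eq prod.case Q p(2) by simp
  next
    fix p assume "p \<in> aligned_reps (9 * n)"
    then obtain x y z where p: "p = (x, y, z)" "x\<^sup>2 + y\<^sup>2 + z\<^sup>2 = 9 * n" "\<not> 3 dvd x" "3 dvd y - x" "3 dvd z - x"
      by (auto simp: aligned_reps_def)
    from p(4,5) obtain b c where "y - x = 3 * b" "z - x = 3 * c" by (elim dvdE)
    then have yz: "y = x + 3 * b" "z = x + 3 * c" by simp_all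
    have "3 * (x * (x + 2 * (b + c))) = 3 * (3 * (n - b\<^sup>2 - c\<^sup>2))"
      using p(2) unfolding yz by (simp add: power2_eq_square algebra_simps)
    then have "x * (x + 2 * (b + c)) = 3 * (n - b\<^sup>2 - c\<^sup>2)" by linarith
    then have "3 dvd x * (x + 2 * (b + c))" by simp
    moreover have "prime (3 :: int)" by simp
    ultimately have "3 dvd x + 2 * (b + c)" using p(3) prime_dvd_mult_iff by blast
    then obtain k where k: "x = 3 * k - 2 * (b + c)" by (elim dvdE) (simp add: algebra_simps)
    \<comment> \<open>The map applied twice is multiplication by 9, so the preimage is the image of
      p divided by 9; its first entry is - (x + 2 (b + c)) / 3 = - k.\<close>
    have r: "?r (- k, b - k, c - k) = p"
      unfolding p(1) yz k by simp
    moreover have "(- k, b - k, c - k) \<in> ?A"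
    proof -
      have "9 * ((- k)\<^sup>2 + (b - k)\<^sup>2 + (c - k)\<^sup>2) = 9 * n"
        using Q[of "- k" "b - k" "c - k"] r p(1,2) by simp
      moreover have "(- k + (b - k) + (c - k)) mod 3 \<noteq> 0" using p(3) unfolding k by presburger
      ultimately show ?thesis by (simp add: squares_reps_def)
    qed
    ultimately show "p \<in> ?r ` ?A" using image_eqI[of p ?r "(- k, b - k, c - k)" ?A] by (simp only:)
  qed
qed

text \<open>Triples divisible by 3 contribute s(n); the others contribute 4 (s(n) - M(n)) through
  signs and reflection.\<close>

lemma card_squares_reps_9:
  assumes "finite (squares_reps n)" "finite (squares_reps (9 * n))"
  shows "int (card (squares_reps (9 * n))) = 5 * int (card (squares_reps n))
    - 4 * int (card {(u, v, w). (u, v, w) \<in> squares_reps n \<and> (u + v + w) mod 3 = 0})"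
proof -
  let ?D = "{(x, y, z). (x, y, z) \<in> squares_reps (9 * n) \<and> 3 dvd x}"
  let ?N = "{(x, y, z). (x, y, z) \<in> squares_reps (9 * n) \<and> \<not> 3 dvd x}"
  let ?Z = "{(u, v, w). (u, v, w) \<in> squares_reps n \<and> (u + v + w) mod 3 = 0}"
  let ?M = "{(u, v, w). (u, v, w) \<in> squares_reps n \<and> (u + v + w) mod 3 \<noteq> 0}"
  have sub: "?D \<subseteq> squares_reps (9 * n)" "?N \<subseteq> squares_reps (9 * n)" "?Z \<subseteq> squares_reps n" "?M \<subseteq> squares_reps n" by auto
  have "squares_reps (9 * n) = ?D \<union> ?N" "?D \<inter> ?N = {}" by auto
  then have 1: "card (squares_reps (9 * n)) = card ?D + card ?N"
    using sub assms by (metis (no_types, lifting) card_Un_disjoint finite_subset)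
  have "squares_reps n = ?Z \<union> ?M" "?Z \<inter> ?M = {}" by auto
  then have 2: "card (squares_reps n) = card ?Z + card ?M"
    using sub assms by (metis (no_types, lifting) card_Un_disjoint finite_subset)
  have 3: "card ?D = card (squares_reps n)" using bij_betw_same_card[OF bij_betw_triple] by simp
  have 4: "card ?N = 4 * card (aligned_reps (9 * n))"
    using bij_betw_same_card[OF bij_betw_signs, of n] by (simp add: card_cartesian_product)
  have 5: "card ?M = card (aligned_reps (9 * n))" by (rule bij_betw_same_card[OF bij_betw_reflection])
  from 1 2 3 4 5 show ?thesis by simp
qed

section \<open>Generating functions and comparison of coefficients\<close>

lemma sums_squares_reps:
  assumes "0 < q" "q < 1"
  shows "finite (squares_reps (int n))"
    and "(\<lambda>n. real (card (squares_reps (int n))) * q ^ n) sums (theta 1 q) ^ 3"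
proof -
  let ?k = "(\<lambda>(u, v, w). u\<^sup>2 + v\<^sup>2 + w\<^sup>2) :: int \<times> int \<times> int \<Rightarrow> int"
  have S: "{p \<in> UNIV. ?k p = int n} = squares_reps (int n)" for n
    by (auto simp: squares_reps_def)
  have "((\<lambda>p. q powi ?k p) has_sum (theta 1 q) ^ 3) UNIV"
    using has_sum_theta_triple[OF assms, of 1 1]
    by (simp add: case_prod_unfold power2_eq_square power3_eq_cube mult.assoc)
  note fibres = has_sum_fibres[OF this]
  show "finite (squares_reps (int n))" "(\<lambda>n. real (card (squares_reps (int n))) * q ^ n) sums (theta 1 q) ^ 3"
    using fibres(1)[of n] fibres(2) assms(1) unfolding S by auto
qed

lemma sums_squares_reps_mod_3:
  assumes "0 < q" "q < 1"
  shows "(\<lambda>n. real (card {(u, v, w). (u, v, w) \<in> squares_reps (int n) \<and> (u + v + w) mod 3 = 0}) * q ^ n)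
    sums (theta 1 (q ^ 3) * hex 1 (q\<^sup>2))"
proof -
  let ?k = "(\<lambda>(u, v, w). u\<^sup>2 + v\<^sup>2 + w\<^sup>2) :: int \<times> int \<times> int \<Rightarrow> int"
  have S: "{p \<in> {(u, v, w). (u + v + w) mod 3 = 0}. ?k p = int n} =
      {(u, v, w). (u, v, w) \<in> squares_reps (int n) \<and> (u + v + w) mod 3 = 0}" for n
    by (auto simp: squares_reps_def)
  have "((\<lambda>p. q powi ?k p) has_sum (theta 1 (q ^ 3) * hex 1 (q\<^sup>2))) {(u, v, w). (u + v + w) mod 3 = 0}"
    using has_sum_theta_triple_mod_0[OF assms, of 1 1] by (simp add: case_prod_unfold)
  from has_sum_fibres(2)[OF this] show ?thesis
    using assms(1) unfolding S by auto
qed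

lemma sums_card_hex_form:
  assumes "0 < q" "q < 1" "0 < r"
  shows "(\<lambda>n. real (card {(z, x, y). 3 * z\<^sup>2 + int r * (x\<^sup>2 + x * y + y\<^sup>2) = int n}) * q ^ n)
    sums (theta 1 (q ^ 3) * hex 1 (q ^ r))"
proof -
  let ?k = "(\<lambda>(z, x, y). 3 * z\<^sup>2 + int r * (x\<^sup>2 + x * y + y\<^sup>2)) :: int \<times> int \<times> int \<Rightarrow> int"
  have "0 \<le> ?k p" for p
  proof -
    have "0 \<le> x\<^sup>2 + x * y + y\<^sup>2" for x y :: int
    proof -
      have "0 \<le> x\<^sup>2 + (x + y)\<^sup>2 + y\<^sup>2" by simp
      then show ?thesis by (simp add: power2_sum)
    qed
    then show ?thesis by (auto split: prod.split)
  qed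
  moreover have "((\<lambda>p. q powi ?k p) has_sum (theta 1 (q ^ 3) * hex 1 (q ^ r))) UNIV"
    using has_sum_times[OF has_sum_theta[of "q ^ 3" 1] has_sum_hex[of "q ^ r" 1]] assms
      power_less_one[OF assms(1,2), of 3] power_less_one[OF assms]
    by (simp add: case_prod_unfold power_int_power power_int_add)
  moreover have "{p \<in> UNIV. ?k p = int n} = {(z, x, y). 3 * z\<^sup>2 + int r * (x\<^sup>2 + x * y + y\<^sup>2) = int n}" for n
    by auto
  ultimately show ?thesis using has_sum_fibres(2)[where k = ?k and S = UNIV and q = q] assms(1) by simp
qed

lemma ternary_reps_eq_card_hex_form:
  "ternary_reps 1 1 3 0 0 1 n = card {(z, x, y). 3 * z\<^sup>2 + int 1 * (x\<^sup>2 + x * y + y\<^sup>2) = n}"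
  "ternary_reps 4 3 4 0 4 0 n = card {(y, x, z). 3 * y\<^sup>2 + int 4 * (x\<^sup>2 + x * z + z\<^sup>2) = n}"
proof -
  show "ternary_reps 1 1 3 0 0 1 n = card {(z, x, y). 3 * z\<^sup>2 + int 1 * (x\<^sup>2 + x * y + y\<^sup>2) = n}"
    unfolding ternary_reps_def
    by (rule bij_betw_same_card[of "\<lambda>(x, y, z). (z, x, y)"], rule bij_betwI[of _ _ _ "\<lambda>(z, x, y). (x, y, z)"])
       (auto simp: algebra_simps)
  show "ternary_reps 4 3 4 0 4 0 n = card {(y, x, z). 3 * y\<^sup>2 + int 4 * (x\<^sup>2 + x * z + z\<^sup>2) = n}"
    unfolding ternary_reps_def
    by (rule bij_betw_same_card[of "\<lambda>(x, y, z). (y, x, z)"], rule bij_betwI[of _ _ _ "\<lambda>(y, x, z). (x, y, z)"])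
       (auto simp: algebra_simps)
qed

lemma sums_ternary_reps:
  assumes "0 < q" "q < 1"
  shows "(\<lambda>n. real (ternary_reps 1 1 3 0 0 1 (int n)) * q ^ n) sums (theta 1 (q ^ 3) * hex 1 q)"
    and "(\<lambda>n. real (ternary_reps 4 3 4 0 4 0 (int n)) * q ^ n) sums (theta 1 (q ^ 3) * hex 1 (q ^ 4))"
  unfolding ternary_reps_eq_card_hex_form
  using sums_card_hex_form[OF assms, of 1] sums_card_hex_form[OF assms, of 4] by simp_all

text \<open>Coefficient comparison in \<open>theta_cubed\<close>, whose validity on 0 < q < 1/3
  suffices for \<open>powser_zero_coeffs\<close>.\<close>

lemma squares_reps_eq_ternary_reps:
  "int (card (squares_reps (int n))) -
     2 * int (card {(u, v, w). (u, v, w) \<in> squares_reps (int n) \<and> (u + v + w) mod 3 = 0}) =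
   int (ternary_reps 1 1 3 0 0 1 (int n)) - 2 * int (ternary_reps 4 3 4 0 4 0 (int n))"
proof -
  define s where "s n = real (card (squares_reps (int n)))" for n
  define m where "m n = real (card {(u, v, w). (u, v, w) \<in> squares_reps (int n) \<and> (u + v + w) mod 3 = 0})" for n
  define f where "f n = real (ternary_reps 1 1 3 0 0 1 (int n))" for n
  define g where "g n = real (ternary_reps 4 3 4 0 4 0 (int n))" for n
  have "s n - 2 * m n - (f n - 2 * g n) = 0" for n
  proof (rule powser_zero_coeffs[of "1 / 3"])
    fix q :: real assume q: "0 < q" "q < 1 / 3"
    then have q1: "0 < q" "q < 1" by auto
    have "(\<lambda>n. s n * q ^ n - 2 * (m n * q ^ n) - (f n * q ^ n - 2 * (g n * q ^ n))) sums
        ((theta 1 q) ^ 3 - 2 * (theta 1 (q ^ 3) * hex 1 (q\<^sup>2)) - (theta 1 (q ^ 3) * hex 1 q - 2 * (theta 1 (q ^ 3) * hex 1 (q ^ 4))))"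
      unfolding s_def m_def f_def g_def using q1
      by (intro sums_diff sums_mult sums_squares_reps sums_squares_reps_mod_3 sums_ternary_reps)
    moreover have "(theta 1 q) ^ 3 - 2 * (theta 1 (q ^ 3) * hex 1 (q\<^sup>2)) - (theta 1 (q ^ 3) * hex 1 q - 2 * (theta 1 (q ^ 3) * hex 1 (q ^ 4))) = 0"
      using theta_cubed[of q] q by (simp add: algebra_simps)
    ultimately show "(\<lambda>n. (s n - 2 * m n - (f n - 2 * g n)) * q ^ n) sums 0"
      by (simp add: algebra_simps)
  qed simp
  from this[of n] show ?thesis unfolding s_def m_def f_def g_def by linarith
qed

theorem theorem5p2:
  fixes n :: int
  assumes "n \<ge> 0"
  shows "int (three_squares_reps (9 * n)) - 3 * int (three_squares_reps n) =
         2 * int (ternary_reps 1 1 3 0 0 1 n) - 4 * int (ternary_reps 4 3 4 0 4 0 n)"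
proof -
  obtain k where k: "n = int k" using assms by (rule nonneg_int_cases)
  have three_squares: "three_squares_reps m = card (squares_reps m)" for m
    by (simp add: three_squares_reps_def squares_reps_def)
  \<comment> \<open>Finiteness does not involve q; 1/2 is an arbitrary point of (0, 1).\<close>
  have fin: "finite (squares_reps (int j))" for j using sums_squares_reps(1)[of "1 / 2" j] by simp
  have "finite (squares_reps n)" "finite (squares_reps (9 * n))"
    using fin[of k] fin[of "9 * k"] by (simp_all add: k)
  \<comment> \<open>s(9 n) - 3 s(n) = 2 (s(n) - 2 M(n)), and the bracket has just been expressed by
    the two ternary forms.\<close>
  from card_squares_reps_9[OF this] squares_reps_eq_ternary_reps[of k] show ?thesis
    unfolding three_squares k by linarith
qed

end
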